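(* Let $k>l$ be positive integers, and let $G$ be a finite abelian group of order $n>1$ and exponent $v$. For a positive integer $d$, set $\delta(d)=\gcd(d,k-l)$. If $v$ possesses at least one positive divisor $d$ which is not congruent modulo $k+l$ to any integer between $1$ and $\delta(d)$ (inclusive), then $$\lambda_{k,l}(G)= \lambda_{k,l}(\mathbb{Z}_{v}) \cdot \frac{n}{v}.$$
   Context: $G$ is written additively; its exponent $v$ is the largest order of any element of $G$, and $\mathbb{Z}_v$ is the cyclic group of order $v$. For a positive integer $h$ and a subset $A$ of an abelian group, $hA$ denotes the set of all sums of $h$ (not necessarily distinct) elements of $A$. For distinct positive integers $k,l$, a subset $A$ is called $(k,l)$-sum-free if $kA\cap lA=\emptyset$. For a finite abelian group $H$, $\lambda_{k,l}(H)$ denotes the maximum size of a $(k,l)$-sum-free subset of $H$ (the empty set counts as $(k,l)$-sum-free). *)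

theory Defs
  imports
    "HOL-Algebra.Elementary_Groups"
    "HOL-Algebra.Multiplicative_Group"
    "HOL-Number_Theory.Cong"
begin

text \<open>
  HOL-Algebra writes groups multiplicatively, so the sum of \<open>h\<close> elements in the additive notation
  is a \<open>finprod\<close> here. Since \<open>finprod\<close> is only meaningful for commutative monoids, the
  definitions below are intended for abelian groups; the maxima are intended for finite ones.
\<close>

definition hfold :: "('a, 'b) monoid_scheme \<Rightarrow> nat \<Rightarrow> 'a set \<Rightarrow> 'a set"
  where "hfold H h A = {finprod H f {..<h} | f. f \<in> {..<h} \<rightarrow> A}"

definition sum_free :: "('a, 'b) monoid_scheme \<Rightarrow> nat \<Rightarrow> nat \<Rightarrow> 'a set \<Rightarrow> bool"
  where "sum_free H k l A \<longleftrightarrow> A \<subseteq> carrier H \<and> hfold H k A \<inter> hfold H l A = {}"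

definition max_sum_free :: "nat \<Rightarrow> nat \<Rightarrow> ('a, 'b) monoid_scheme \<Rightarrow> nat"
  where "max_sum_free k l H = Max {card A | A. sum_free H k l A}"

definition group_exponent :: "('a, 'b) monoid_scheme \<Rightarrow> nat"
  where "group_exponent H = Max (group.ord H ` carrier H)"

end

theory Submission
  imports Defs
begin

text \<open>
  The idea, in additive notation, with \<open>n\<close> the order and \<open>v\<close> the exponent of \<open>G\<close>.

  The preimage of a \<open>(k,l)\<close>-sum-free set under a homomorphism is \<open>(k,l)\<close>-sum-free, and if the
  homomorphism is onto, then the preimage has the same density. An element of order \<open>v\<close> generates a
  direct factor of \<open>G\<close>, so \<open>G\<close> maps onto \<open>\<int>\<^sub>v\<close> and the largest density in \<open>G\<close> is at least the one
  in \<open>\<int>\<^sub>v\<close>.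

  For the other inequality, let \<open>d\<close> be the divisor of \<open>v\<close> in the hypothesis. What the hypothesis
  says is that \<open>\<int>\<^sub>d\<close> contains a sum-free interval of density at least \<open>1/(k+l)\<close>
  (\<open>exists_sum_free_interval\<close>); so the largest density in \<open>\<int>\<^sub>v\<close> is at least \<open>1/(k+l)\<close>. Only sum-free
  sets \<open>A\<close> with \<open>(k+l)|A| > n\<close> remain. These come from cyclic groups: for some subgroup \<open>H\<close>, the
  image of \<open>A\<close> in \<open>G/H\<close> is still sum-free and lies in a cyclic subgroup of \<open>G/H\<close>. Such a subgroup
  is an image of \<open>\<int>\<^sub>v\<close>, and pulling back to \<open>\<int>\<^sub>v\<close> bounds the density of \<open>A\<close>. For \<open>H\<close> one takes a
  subgroup of largest size such that \<open>kA\<close> and \<open>lA\<close> stay disjoint modulo \<open>H\<close>, and one has to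
  see that \<open>H\<close> could be enlarged if the image of \<open>A\<close> were not in a cyclic subgroup
  (\<open>dense_sum_free_cyclic_or_enlarge\<close>, applied to \<open>G/H\<close>).

  So let \<open>A\<close> be sum-free in a group of order \<open>n < (k+l)|A|\<close>. As \<open>|kA| + |lA| \<le> n\<close>, not every step
  from \<open>jA\<close> to \<open>(j+1)A\<close> gains \<open>|A|\<close> elements: some \<open>T = jA\<close> has \<open>|T+A| < |T| + |A|\<close>. The
  isoperimetric method of Hamidoune, that is, the study of the sets \<open>X\<close> that minimise
  \<open>|X+A| - |X|\<close>, which is a submodular function of \<open>X\<close>, turns such a \<open>T\<close> into a subgroup: either
  the group is cyclic, or it has a proper non-trivial subgroup \<open>N\<close> with \<open>|N+A| < |N| + |A|\<close>
  (\<open>cyclic_or_critical_subgroup\<close>). In the second case \<open>A\<close> misses fewer than \<open>|N|\<close> elements of the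
  cosets of \<open>N\<close> that it meets, so its parts in two different cosets add up to a whole coset. Hence
  \<open>kA\<close> and \<open>lA\<close> could share a coset of \<open>N\<close> only by sharing an element, and \<open>N\<close> is the wanted
  enlargement (\<open>nearly_periodic_sum_free\<close>).

  One configuration needs separate care. If \<open>A\<close> lies in a coset of a proper subgroup \<open>M\<close>, generated
  by the differences of \<open>A\<close>, and \<open>kA\<close>, \<open>lA\<close> lie in the same coset of \<open>M\<close>, then
  \<open>|kA| + |lA| \<le> n/2\<close>, which is too small even for Olson's general bound that each step gains at
  least \<open>|A|/2\<close> elements (\<open>excess_ge_half\<close>).
\<close>

(* The multiset order uses the symbol of left cosets. *)
no_notation subset_mset (infix \<open><#\<close> 50)

locale finite_abelian_group = comm_group +
  assumes finite_carrier [simp]: "finite (carrier G)"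
begin

section \<open>Product sets\<close>

lemma mem_set_mult: "x \<in> X \<Longrightarrow> y \<in> Y \<Longrightarrow> x \<otimes> y \<in> X <#> Y"
  by (auto simp: set_mult_def)

lemma set_multE:
  assumes "z \<in> X <#> Y"
  obtains x y where "x \<in> X" "y \<in> Y" "z = x \<otimes> y"
  using assms by (auto simp: set_mult_def)

lemma finite_subset_carrier: "X \<subseteq> carrier G \<Longrightarrow> finite X"
  using finite_carrier finite_subset by blast

lemma finite_set_mult [simp]: "X \<subseteq> carrier G \<Longrightarrow> S \<subseteq> carrier G \<Longrightarrow> finite (X <#> S)"
  by (meson finite_subset_carrier set_mult_closed)

lemma l_coset_image: "a <# X = (\<lambda>x. a \<otimes> x) ` X"
  by (auto simp: l_coset_def)

lemma card_l_coset [simp]: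
  assumes "a \<in> carrier G" "X \<subseteq> carrier G"
  shows "card (a <# X) = card X"
proof -
  have "inj_on (\<lambda>x. a \<otimes> x) X"
    using assms by (auto simp: inj_on_def subset_iff)
  then show ?thesis
    by (simp add: l_coset_image card_image)
qed

lemma mem_l_coset_iff:
  assumes "a \<in> carrier G" "X \<subseteq> carrier G" "y \<in> carrier G"
  shows "y \<in> a <# X \<longleftrightarrow> inv a \<otimes> y \<in> X"
proof
  assume "y \<in> a <# X"
  then obtain x where "x \<in> X" "y = a \<otimes> x"
    by (auto simp: l_coset_image)
  then show "inv a \<otimes> y \<in> X"
    using assms by (simp add: m_assoc [symmetric] subset_iff)
next
  assume *: "inv a \<otimes> y \<in> X"
  have "y = a \<otimes> (inv a \<otimes> y)"
    using assms by (simp add: m_assoc [symmetric])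
  with * show "y \<in> a <# X"
    by (auto simp: l_coset_image)
qed

lemma set_mult_comm:
  assumes "X \<subseteq> carrier G" "Y \<subseteq> carrier G"
  shows "X <#> Y = Y <#> X"
proof -
  have "A <#> B \<subseteq> B <#> A" if "A \<subseteq> carrier G" "B \<subseteq> carrier G" for A B
  proof
    fix z assume "z \<in> A <#> B"
    then obtain x y where xy: "x \<in> A" "y \<in> B" "z = x \<otimes> y" by (rule set_multE)
    then have "z = y \<otimes> x" using that by (simp add: m_comm subset_iff)
    then show "z \<in> B <#> A" using xy mem_set_mult by blast
  qed
  then show ?thesis using assms by blast
qed

lemma set_mult_Un_left: "(X \<union> Y) <#> S = (X <#> S) \<union> (Y <#> S)"
  by (auto simp: set_mult_def)

lemma set_mult_Int_left: "(X \<inter> Y) <#> S \<subseteq> (X <#> S) \<inter> (Y <#> S)"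
  by (auto simp: set_mult_def)

lemma card_set_mult_ge:
  assumes "X \<subseteq> carrier G" "S \<subseteq> carrier G" "S \<noteq> {}"
  shows "card X \<le> card (X <#> S)"
proof -
  obtain s where s: "s \<in> S" using assms by auto
  have "s <# X \<subseteq> X <#> S"
  proof -
    have "s <# X = X <#> {s}"
      using s assms by (subst set_mult_comm) (auto simp: l_coset_eq_set_mult)
    also have "\<dots> \<subseteq> X <#> S"
      using s by (intro mono_set_mult) auto
    finally show ?thesis .
  qed
  then have "card (s <# X) \<le> card (X <#> S)"
    using assms by (intro card_mono) auto
  then show ?thesis
    using s assms by auto
qed

lemma one_l_coset [simp]: "X \<subseteq> carrier G \<Longrightarrow> \<one> <# X = X"
  by (rule lcos_mult_one)

lemma l_coset_set_mult:
  assumes "a \<in> carrier G" "X \<subseteq> carrier G" "S \<subseteq> carrier G"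
  shows "(a <# X) <#> S = a <# (X <#> S)"
  using assms by (simp add: l_coset_eq_set_mult set_mult_assoc)

section \<open>The excess of a set\<close>

definition excess :: "'a set \<Rightarrow> 'a set \<Rightarrow> int"
  where "excess S X = int (card (X <#> S)) - int (card X)"

lemma excess_l_coset [simp]:
  assumes "a \<in> carrier G" "X \<subseteq> carrier G" "S \<subseteq> carrier G"
  shows "excess S (a <# X) = excess S X"
  using assms by (simp add: excess_def l_coset_set_mult set_mult_closed)

lemma excess_submodular:
  assumes "X \<subseteq> carrier G" "Y \<subseteq> carrier G" "S \<subseteq> carrier G"
  shows "excess S (X \<inter> Y) + excess S (X \<union> Y) \<le> excess S X + excess S Y"
proof -
  have "card ((X \<inter> Y) <#> S) \<le> card ((X <#> S) \<inter> (Y <#> S))"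
    using assms by (intro card_mono set_mult_Int_left) auto
  moreover have "card ((X \<union> Y) <#> S) + card ((X <#> S) \<inter> (Y <#> S))
      = card (X <#> S) + card (Y <#> S)"
    using assms card_Un_Int[of "X <#> S" "Y <#> S"] by (simp add: set_mult_Un_left)
  moreover have "card (X \<union> Y) + card (X \<inter> Y) = card X + card Y"
    using assms card_Un_Int[of X Y] by (simp add: finite_subset_carrier)
  ultimately show ?thesis
    by (simp add: excess_def)
qed

lemma subgroup_if_division_closed:
  assumes "X \<subseteq> carrier G" "X \<noteq> {}"
    and "\<And>x y. x \<in> X \<Longrightarrow> y \<in> X \<Longrightarrow> inv x \<otimes> y \<in> X"
  shows "subgroup X G"
proof (rule subgroupI)
  show "X \<subseteq> carrier G" "X \<noteq> {}" by fact+
  obtain x where "x \<in> X" using assms by auto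
  with assms(1) assms(3)[of x x] have one: "\<one> \<in> X" by (auto simp: subset_iff)
  show inv: "inv a \<in> X" if "a \<in> X" for a
    using assms(3)[OF that one] that assms(1) by (auto simp: subset_iff)
  show "a \<otimes> b \<in> X" if "a \<in> X" "b \<in> X" for a b
    using assms(3)[OF inv[OF that(1)] that(2)] that assms(1) by (auto simp: subset_iff)
qed

text \<open>
  Among the non-empty subsets of \<open>U\<close> that minimise the excess, one of largest size through \<open>\<one>\<close> is a
  subgroup: by submodularity it absorbs every minimiser that it meets, in particular its own
  translates. It is not trivial, for \<open>{\<one>}\<close> has excess \<open>card S - 1\<close>: either the minimum is smaller
  than that, or \<open>F\<close> itself is a minimiser and gets absorbed.
\<close>

lemma exists_subgroup_of_small_excess:
  assumes U: "subgroup U G" and F: "F \<subseteq> U" "\<one> \<in> F" "2 \<le> card F"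
    and S: "S \<subseteq> carrier G" and small: "excess S F < int (card S)"
  shows "\<exists>P. subgroup P G \<and> P \<subseteq> U \<and> P \<noteq> {\<one>} \<and> excess S P < int (card S)"
proof -
  have UG: "U \<subseteq> carrier G"
    using U by (rule subgroup.subset)
  define D where "D = Pow U - {{}}"
  have D: "finite D" "F \<in> D" "{\<one>} \<in> D"
    using UG F by (auto simp: D_def finite_subset_carrier subgroup.one_closed[OF U])
  define c where "c = Min (excess S ` D)"
  have c_le: "c \<le> excess S X" if "X \<in> D" for X
    using D that by (simp add: c_def)
  have "c \<in> excess S ` D"
    unfolding c_def using D by (intro Min_in) auto
  then obtain X1 where X1: "X1 \<in> D" "excess S X1 = c" by auto
  define E where "E = {X \<in> D. excess S X = c}"
  have E: "finite E" "E \<noteq> {}"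
    using D X1 by (auto simp: E_def)
  define m where "m = Max (card ` E)"
  have "m \<in> card ` E"
    unfolding m_def using E by (intro Max_in) auto
  then obtain X0 where X0: "X0 \<in> E" "card X0 = m" by auto
  have le_m: "card Y \<le> m" if "Y \<in> E" for Y
    using that E by (simp add: m_def)
  have E_translate: "a <# Y \<in> E" if "a \<in> U" "Y \<in> E" for a Y
  proof -
    have "Y \<subseteq> U" "Y \<noteq> {}" "excess S Y = c" using that by (auto simp: E_def D_def)
    moreover have "a <# Y \<subseteq> U" "a <# Y \<noteq> {}"
      using that(1) calculation U by (auto simp: l_coset_image subgroup.m_closed subset_iff)
    ultimately show ?thesis
      using subsetD[OF UG that(1)] UG S excess_l_coset[of a Y S] by (auto simp: E_def D_def)
  qed
  obtain x0 where x0: "x0 \<in> X0" using X0 by (auto simp: E_def D_def)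
  have x0U: "x0 \<in> U" using x0 X0 by (auto simp: E_def D_def)
  define X where "X = inv x0 <# X0"
  have XE: "X \<in> E"
    unfolding X_def using x0U U by (intro E_translate X0) (simp add: subgroup.m_inv_closed)
  have X: "X \<in> D" "excess S X = c" "X \<subseteq> U" "X \<subseteq> carrier G"
    using XE UG by (auto simp: E_def D_def)
  have X0G: "X0 \<subseteq> carrier G" using X0 UG by (auto simp: E_def D_def)
  have cardX: "card X = m"
    using X0 x0U UG X0G by (simp add: X_def subset_iff)
  have oneX: "\<one> \<in> X"
    using x0 x0U UG by (force simp: X_def l_coset_image image_iff)
  have absorb: "Y \<subseteq> X" if Y: "Y \<in> E" "X \<inter> Y \<noteq> {}" for Y
  proof -
    have YG: "Y \<subseteq> carrier G" "Y \<subseteq> U" and eY: "excess S Y = c"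
      using Y UG by (auto simp: E_def D_def)
    have "X \<inter> Y \<in> D" "X \<union> Y \<in> D"
      using Y X YG by (auto simp: D_def)
    then have "c \<le> excess S (X \<inter> Y)" "c \<le> excess S (X \<union> Y)"
      by (auto intro: c_le)
    then have "excess S (X \<union> Y) = c"
      using excess_submodular[OF X(4) YG(1) S] X(2) eY by linarith
    then have "X \<union> Y \<in> E"
      using X YG by (auto simp: E_def D_def)
    then have "card (X \<union> Y) \<le> card X"
      using le_m cardX by simp
    then have "X = X \<union> Y"
      using X(4) YG by (intro card_seteq) (auto simp: finite_subset_carrier)
    then show ?thesis by blast
  qed
  have subX: "subgroup X G"
  proof (rule subgroup_if_division_closed)
    show "X \<subseteq> carrier G" "X \<noteq> {}" using X oneX by auto
    fix x y assume xy: "x \<in> X" "y \<in> X"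
    have xU: "x \<in> U" "x \<in> carrier G" using xy X by auto
    have 1: "\<one> \<in> inv x <# X"
      using xy xU by (force simp: l_coset_image image_iff)
    have "inv x <# X \<subseteq> X"
    proof (rule absorb)
      show "inv x <# X \<in> E"
        using xU U XE by (intro E_translate) (auto simp: subgroup.m_inv_closed)
    qed (use 1 oneX in auto)
    then show "inv x \<otimes> y \<in> X"
      using xy by (auto simp: l_coset_image)
  qed
  have one_excess: "excess S {\<one>} = int (card S) - 1"
    using S l_coset_eq_set_mult[of G \<one> S] by (simp add: excess_def)
  \<comment> \<open>If \<open>X\<close> were trivial, the minimum would be \<open>card S - 1\<close> and \<open>F\<close> would be a minimiser.\<close>
  have "X \<noteq> {\<one>}"
  proof
    assume X1: "X = {\<one>}"
    have "c \<le> excess S F" using D by (intro c_le)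
    with small one_excess X1 X(2) have "excess S F = c" by simp
    then have "F \<in> E" using D by (auto simp: E_def)
    then have "F \<subseteq> X" using F oneX by (intro absorb) auto
    with F(3) show False using X1 by (auto dest: card_mono[rotated])
  qed
  moreover have "excess S X < int (card S)"
    using X(2) c_le[OF D(2)] small by simp
  ultimately show ?thesis
    using subX X by blast
qed

section \<open>Fragments and atoms\<close>

text \<open>
  These are the \<open>r\<close>-fragments and \<open>r\<close>-atoms of Hamidoune. An admissible set has at least \<open>r\<close> elements
  and its product with \<open>S\<close> misses at least \<open>r\<close> elements; the second condition is the image of the
  first one under the duality \<open>fragment_complement\<close>.
\<close>

definition admissible :: "nat \<Rightarrow> 'a set \<Rightarrow> 'a set \<Rightarrow> bool"
  where "admissible r S X \<longleftrightarrow>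
    X \<subseteq> carrier G \<and> r \<le> card X \<and> card (X <#> S) + r \<le> order G"

definition fragment :: "nat \<Rightarrow> 'a set \<Rightarrow> 'a set \<Rightarrow> bool"
  where "fragment r S X \<longleftrightarrow>
    admissible r S X \<and> (\<forall>Y. admissible r S Y \<longrightarrow> excess S X \<le> excess S Y)"

definition atom :: "nat \<Rightarrow> 'a set \<Rightarrow> 'a set \<Rightarrow> bool"
  where "atom r S X \<longleftrightarrow> fragment r S X \<and> (\<forall>Y. fragment r S Y \<longrightarrow> card X \<le> card Y)"

lemma atom_carrier: "atom r S X \<Longrightarrow> X \<subseteq> carrier G"
  by (auto simp: atom_def fragment_def admissible_def)

lemma atom_l_coset:
  assumes "atom r S X" "a \<in> carrier G" "S \<subseteq> carrier G"
  shows "atom r S (a <# X)"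
  using assms atom_carrier[OF assms(1)] l_coset_subset_G[of X a]
  by (simp add: atom_def fragment_def admissible_def l_coset_set_mult set_mult_closed)

text \<open>
  If \<open>Y\<close> is the set of the inverses of the elements outside of \<open>X <#> S\<close>, then \<open>Y <#> S\<close> misses
  every inverse of an element of \<open>X\<close>. So \<open>Y\<close> has at most the excess of \<open>X\<close>. Taking inverses makes
  \<open>Y\<close> a fragment for \<open>S\<close> itself and not for the inverse of \<open>S\<close>.
\<close>

lemma fragment_complement:
  assumes X: "fragment r S X" and S: "S \<subseteq> carrier G"
  shows "\<exists>Y. fragment r S Y \<and> card Y = order G - card (X <#> S)"
proof -
  have XG: "X \<subseteq> carrier G" "r \<le> card X" "card (X <#> S) + r \<le> order G"
    using X by (auto simp: fragment_def admissible_def)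
  have XS: "X <#> S \<subseteq> carrier G"
    using XG S by (intro set_mult_closed)
  define Y where "Y = (\<lambda>x. inv x) ` (carrier G - (X <#> S))"
  have inj: "inj_on (\<lambda>x. inv x) A" if "A \<subseteq> carrier G" for A
    using that by (auto simp: inj_on_def subset_iff)
  have card_Y: "card Y = order G - card (X <#> S)"
    using XS card_image[OF inj, of "carrier G - (X <#> S)"]
      card_Diff_subset[of "X <#> S" "carrier G"] by (simp add: Y_def finite_subset_carrier order_def)
  have YG: "Y \<subseteq> carrier G"
    by (auto simp: Y_def)
  have "(Y <#> S) \<inter> (\<lambda>x. inv x) ` X = {}"
  proof (rule ccontr)
    assume "(Y <#> S) \<inter> (\<lambda>x. inv x) ` X \<noteq> {}"
    then obtain z where z: "z \<in> Y <#> S" "z \<in> (\<lambda>x. inv x) ` X" by blast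
    from z(1) obtain y' s where ys: "y' \<in> Y" "s \<in> S" "z = y' \<otimes> s" by (rule set_multE)
    then obtain y x where *: "y \<in> carrier G" "y \<notin> X <#> S" "s \<in> S" "x \<in> X"
        "inv y \<otimes> s = inv x"
      using z(2) by (auto simp: Y_def)
    have G: "s \<in> carrier G" "x \<in> carrier G" using * S XG by auto
    have "s = y \<otimes> inv x"
      using * G by (metis inv_closed inv_solve_left)
    then have "x \<otimes> s = y"
      using * G by (metis inv_closed m_comm m_lcomm r_inv r_one)
    then show False using *(2) mem_set_mult[OF *(4,3)] by simp
  qed
  then have "card (Y <#> S) + card ((\<lambda>x. inv x) ` X) = card ((Y <#> S) \<union> (\<lambda>x. inv x) ` X)"
    using YG S XG by (intro card_Un_disjoint [symmetric]) (auto simp: finite_subset_carrier)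
  also have "\<dots> \<le> card (carrier G)"
    using YG S XG set_mult_closed[OF YG S] by (intro card_mono) auto
  finally have le: "card (Y <#> S) + card X \<le> order G"
    using XG by (simp add: card_image inj order_def)
  have "admissible r S Y"
    using le card_Y XG YG by (auto simp: admissible_def)
  moreover have "excess S Y \<le> excess S X"
    using le card_Y XG by (simp add: excess_def)
  ultimately have "fragment r S Y"
    using X by (auto simp: fragment_def intro: order_trans)
  then show ?thesis using card_Y by blast
qed

text \<open>
  Submodularity makes \<open>F \<inter> X\<close> a fragment, which by minimality of the atom is all of \<open>F\<close>, provided
  that \<open>F \<union> X\<close> is admissible. The only doubt is whether \<open>(F \<union> X) <#> S\<close> leaves out \<open>r\<close> elements. It
  does because the complement of \<open>X <#> S\<close>, being the size of a fragment, has at least \<open>card F\<close>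
  elements, while adding \<open>F\<close> to \<open>X\<close> enlarges \<open>X <#> S\<close> by at most \<open>card F - r\<close>.
\<close>

lemma atom_subset_fragment:
  assumes F: "atom r S F" and X: "fragment r S X" and S: "S \<subseteq> carrier G"
    and meet: "r \<le> card (F \<inter> X)"
  shows "F \<subseteq> X"
proof -
  have FG: "F \<subseteq> carrier G" "card (F <#> S) + r \<le> order G" and FF: "fragment r S F"
    using F by (auto simp: atom_def fragment_def admissible_def)
  have XG: "X \<subseteq> carrier G" "card (X <#> S) + r \<le> order G" "r \<le> card X"
    using X by (auto simp: fragment_def admissible_def)
  have eq: "excess S F = excess S X"
    using FF X by (auto simp: fragment_def intro: antisym)
  have "card ((F \<inter> X) <#> S) \<le> card (F <#> S)"
    using FG S by (intro card_mono mono_set_mult) auto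
  then have int_adm: "admissible r S (F \<inter> X)"
    using FG meet by (auto simp: admissible_def)
  then have ge: "excess S X \<le> excess S (F \<inter> X)"
    using X by (auto simp: fragment_def)
  have sub: "excess S (F \<inter> X) + excess S (F \<union> X) \<le> 2 * excess S X"
    using excess_submodular[OF FG(1) XG(1) S] eq by simp
  obtain Y where "fragment r S Y" "card Y = order G - card (X <#> S)"
    using fragment_complement[OF X S] by blast
  then have "card F \<le> order G - card (X <#> S)"
    using F by (auto simp: atom_def)
  moreover have "card (F \<union> X) + card (F \<inter> X) = card F + card X"
    using FG XG card_Un_Int[of F X] by (simp add: finite_subset_carrier)
  moreover have "excess S (F \<union> X) \<le> excess S X"
    using sub ge by simp
  ultimately have "card ((F \<union> X) <#> S) + r \<le> order G"
    using meet XG(2) unfolding excess_def by linarith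
  moreover have "r \<le> card (F \<union> X)"
    using XG FG card_mono[of "F \<union> X" X] by (simp add: finite_subset_carrier)
  ultimately have "admissible r S (F \<union> X)"
    using FG XG by (auto simp: admissible_def)
  then have "excess S X \<le> excess S (F \<union> X)"
    using X by (auto simp: fragment_def)
  then have "excess S (F \<inter> X) \<le> excess S X"
    using sub by simp
  then have "fragment r S (F \<inter> X)"
    using int_adm X by (auto simp: fragment_def intro: order_trans)
  then have "card F \<le> card (F \<inter> X)"
    using F by (auto simp: atom_def)
  then have "F \<inter> X = F"
    using FG by (intro card_seteq) (auto simp: finite_subset_carrier)
  then show ?thesis by blast
qed

lemma atom_eq_translate:
  assumes F: "atom r S F" and S: "S \<subseteq> carrier G" and a: "a \<in> carrier G"
    and meet: "r \<le> card (F \<inter> (a <# F))"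
  shows "a <# F = F"
proof -
  note FG = atom_carrier[OF F]
  have "fragment r S (a <# F)"
    using atom_l_coset[OF F a S] by (simp add: atom_def)
  then have "F \<subseteq> a <# F"
    using atom_subset_fragment[OF F _ S meet] by simp
  then have "F = a <# F"
    using a FG l_coset_subset_G[OF FG a] by (intro card_seteq) (auto simp: finite_subset_carrier)
  then show ?thesis by simp
qed

text \<open>
  Translating an atom gives an atom, so one may ask for the one that passes through \<open>\<one>\<close>.
\<close>

lemma exists_atom:
  assumes T: "admissible r S T" and r: "1 \<le> r" and S: "S \<subseteq> carrier G"
  shows "\<exists>F. atom r S F \<and> \<one> \<in> F \<and> excess S F \<le> excess S T"
proof -
  let ?A = "{X. admissible r S X}"
  have fin: "finite ?A" by (rule finite_subset[of _ "Pow (carrier G)"]) (auto simp: admissible_def)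
  have A: "arg_min_on (excess S) ?A \<in> ?A" "\<And>Y. Y \<in> ?A \<Longrightarrow> excess S (arg_min_on (excess S) ?A) \<le> excess S Y"
    using T arg_min_if_finite(1)[OF fin, of "excess S"] arg_min_least[OF fin, of _ "excess S"]
    by blast+
  let ?B = "{X. fragment r S X}"
  have "?B \<subseteq> ?A" by (auto simp: fragment_def)
  then have finB: "finite ?B" using fin finite_subset by blast
  have "arg_min_on (excess S) ?A \<in> ?B"
    using A by (auto simp: fragment_def)
  then have neB: "?B \<noteq> {}" by blast
  define F where "F = arg_min_on card ?B"
  have F: "atom r S F"
    using arg_min_if_finite(1)[OF finB neB, of card] arg_min_least[OF finB neB, of _ card]
    by (auto simp: atom_def F_def)
  have FG: "F \<subseteq> carrier G" by (rule atom_carrier[OF F])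
  have "F \<noteq> {}" using F r by (auto simp: atom_def fragment_def admissible_def)
  then obtain x where x: "x \<in> F" by blast
  have xG: "x \<in> carrier G" using x FG by blast
  have "atom r S (inv x <# F)" using F xG S by (intro atom_l_coset) auto
  moreover have "\<one> \<in> inv x <# F"
    using x xG FG by (subst mem_l_coset_iff) auto
  moreover have "excess S (inv x <# F) \<le> excess S T"
    using F T xG FG S by (simp add: atom_def fragment_def)
  ultimately show ?thesis by blast
qed

lemma subgroup_if_stable:
  assumes FG: "F \<subseteq> carrier G" "F \<noteq> {}" and stable: "\<And>x. x \<in> F \<Longrightarrow> inv x <# F = F"
  shows "subgroup F G"
proof (rule subgroup_if_division_closed)
  fix x y assume "x \<in> F" "y \<in> F"
  then show "inv x \<otimes> y \<in> F"
    using stable[of x] by (auto simp: l_coset_image)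
qed (use assms in auto)

lemma atom_1_subgroup:
  assumes F: "atom 1 S F" "\<one> \<in> F" and S: "S \<subseteq> carrier G"
  shows "subgroup F G"
proof (rule subgroup_if_stable)
  show FG: "F \<subseteq> carrier G" by (rule atom_carrier[OF F(1)])
  show "F \<noteq> {}" using F by auto
  fix x assume x: "x \<in> F"
  then have xG: "x \<in> carrier G" using FG by blast
  have "\<one> \<in> inv x <# F" using x xG FG by (subst mem_l_coset_iff) auto
  with F(2) have "{\<one>} \<subseteq> F \<inter> (inv x <# F)" by blast
  then have "card {\<one>} \<le> card (F \<inter> (inv x <# F))"
    using FG by (intro card_mono) (auto simp: finite_subset_carrier)
  then show "inv x <# F = F"
    using xG by (intro atom_eq_translate[OF F(1) S]) auto
qed

text \<open>
  A translate of \<open>F\<close> that shares two elements with \<open>F\<close> is equal to \<open>F\<close>. If this happens for a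
  translation by \<open>g \<noteq> \<one>\<close>, then \<open>F\<close> is invariant under \<open>g\<close>, so all translates of \<open>F\<close> through \<open>\<one>\<close>
  contain \<open>g\<close> as well and therefore coincide with \<open>F\<close>. Otherwise \<open>F\<close> is a Sidon set: its quotients
  \<open>x \<otimes> inv y\<close> with \<open>x \<noteq> y\<close> are distinct.
\<close>

lemma atom_2_subgroup_or_sidon:
  assumes F: "atom 2 S F" "\<one> \<in> F" and S: "S \<subseteq> carrier G"
  shows "subgroup F G \<or> (\<forall>g\<in>carrier G. g \<noteq> \<one> \<longrightarrow> card (F \<inter> (g <# F)) \<le> 1)"
proof (rule disjCI)
  assume "\<not> (\<forall>g\<in>carrier G. g \<noteq> \<one> \<longrightarrow> card (F \<inter> (g <# F)) \<le> 1)"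
  then obtain g where g: "g \<in> carrier G" "g \<noteq> \<one>" "2 \<le> card (F \<inter> (g <# F))"
    by (auto simp: not_le)
  have FG: "F \<subseteq> carrier G" by (rule atom_carrier[OF F(1)])
  have stab: "g <# F = F" by (rule atom_eq_translate[OF F(1) S g(1,3)])
  have gmult: "g \<otimes> x \<in> F" if "x \<in> F" for x
    using that stab by (auto simp: l_coset_image)
  show "subgroup F G"
  proof (rule subgroup_if_stable)
    show "F \<subseteq> carrier G" "F \<noteq> {}" using FG F by auto
    fix x assume x: "x \<in> F"
    then have xG: "x \<in> carrier G" using FG by blast
    have "\<one> \<in> inv x <# F" "g \<in> inv x <# F"
      using x xG FG g gmult[OF x] by (auto simp: mem_l_coset_iff m_comm)
    moreover have "g \<in> F" using gmult[OF F(2)] g by simp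
    ultimately have "{\<one>, g} \<subseteq> F \<inter> (inv x <# F)" using F(2) by blast
    then have "card {\<one>, g} \<le> card (F \<inter> (inv x <# F))"
      using FG by (intro card_mono) (auto simp: finite_subset_carrier)
    then show "inv x <# F = F"
      using xG g(2) by (intro atom_eq_translate[OF F(1) S]) auto
  qed
qed

lemma card_subgroup_set_mult_ge:
  assumes P: "subgroup P G" and S: "S \<subseteq> carrier G" "\<one> \<in> S" "\<not> S \<subseteq> P"
  shows "2 * card P \<le> card (P <#> S)"
proof -
  have PG: "P \<subseteq> carrier G" using P by (rule subgroup.subset)
  obtain s where s: "s \<in> S" "s \<notin> P" using S by blast
  have sG: "s \<in> carrier G" using s S by blast
  have "P \<inter> (s <# P) = {}"
  proof (rule ccontr)
    assume "P \<inter> (s <# P) \<noteq> {}"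
    then obtain p q where "p \<in> P" "q \<in> P" "p = s \<otimes> q" by (auto simp: l_coset_image)
    then have "s = p \<otimes> inv q"
      using sG PG by (metis inv_solve_right subsetD)
    then show False
      using s \<open>p \<in> P\<close> \<open>q \<in> P\<close> P by (simp add: subgroup.m_closed subgroup.m_inv_closed)
  qed
  then have "card P + card (s <# P) = card (P \<union> (s <# P))"
    using PG sG l_coset_subset_G[OF PG sG]
    by (intro card_Un_disjoint [symmetric]) (auto simp: finite_subset_carrier)
  also have "\<dots> \<le> card (P <#> S)"
  proof (intro card_mono Un_least)
    show "P \<subseteq> P <#> S"
    proof
      fix x assume "x \<in> P"
      then show "x \<in> P <#> S"
        using mem_set_mult[of x P \<one> S] S PG by auto
    qed
    show "s <# P \<subseteq> P <#> S"
    proof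
      fix x assume "x \<in> s <# P"
      then obtain p where "p \<in> P" "x = s \<otimes> p" by (auto simp: l_coset_image)
      then show "x \<in> P <#> S"
        using mem_set_mult[of p P s S] s sG PG by (auto simp: m_comm)
    qed
  qed (use PG S in auto)
  finally show ?thesis using PG sG by simp
qed

text \<open>
  Olson's theorem. By minimality it is enough to bound the excess of a \<open>1\<close>-atom. This is a proper
  subgroup \<open>F\<close> that does not contain \<open>S\<close>, so \<open>F <#> S\<close> consists of at least two cosets of \<open>F\<close>. The
  excess of \<open>F\<close> is therefore at least half of the size of \<open>F <#> S\<close>, which contains \<open>S\<close>.
\<close>

lemma excess_ge_half:
  assumes S: "S \<subseteq> carrier G" "\<one> \<in> S"
    and gen: "\<And>P. subgroup P G \<Longrightarrow> S \<subseteq> P \<Longrightarrow> P = carrier G"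
    and T: "T \<subseteq> carrier G" "T \<noteq> {}" "T <#> S \<noteq> carrier G"
  shows "int (card S) \<le> 2 * excess S T"
proof -
  have "T <#> S \<subset> carrier G"
    using set_mult_closed[OF T(1) S(1)] T(3) by blast
  then have "card (T <#> S) < order G"
    unfolding order_def by (intro psubset_card_mono) auto
  then have "admissible 1 S T"
    using T by (auto simp: admissible_def Suc_le_eq card_gt_0_iff finite_subset_carrier)
  then obtain F where F: "atom 1 S F" "\<one> \<in> F" "excess S F \<le> excess S T"
    using exists_atom S by blast
  have subF: "subgroup F G" using atom_1_subgroup F S by blast
  have FG: "F \<subseteq> carrier G" using subF by (rule subgroup.subset)
  have lt: "card (F <#> S) < order G"
    using F by (auto simp: atom_def fragment_def admissible_def)
  have "\<not> S \<subseteq> F"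
  proof
    assume "S \<subseteq> F"
    then have "F = carrier G" using gen subF by blast
    then show False using card_set_mult_ge[OF FG S(1)] S lt by (auto simp: order_def)
  qed
  then have "2 * card F \<le> card (F <#> S)"
    using card_subgroup_set_mult_ge[OF subF] S by blast
  moreover have "card S \<le> card (F <#> S)"
    using card_set_mult_ge[OF S(1) FG] F(2) set_mult_comm[OF S(1) FG] by auto
  ultimately show ?thesis
    using F(3) by (simp add: excess_def)
qed

lemma card_Int_translates_le:
  assumes sidon: "\<forall>g\<in>carrier G. g \<noteq> \<one> \<longrightarrow> card (F \<inter> (g <# F)) \<le> 1"
    and F: "F \<subseteq> carrier G" and ab: "a \<in> carrier G" "b \<in> carrier G" "a \<noteq> b"
  shows "card ((a <# F) \<inter> (b <# F)) \<le> 1"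
proof -
  have ne: "inv a \<otimes> b \<noteq> \<one>"
    using ab by (metis inv_closed inv_equality inv_inv)
  have "(a <# F) \<inter> (b <# F) = a <# (F \<inter> ((inv a \<otimes> b) <# F))"
  proof -
    have "inj_on (\<lambda>x. a \<otimes> x) (carrier G)"
      using ab by (auto simp: inj_on_def)
    then have "a <# (F \<inter> ((inv a \<otimes> b) <# F)) = (a <# F) \<inter> (a <# ((inv a \<otimes> b) <# F))"
      using F ab l_coset_subset_G[OF F, of "inv a \<otimes> b"]
      unfolding l_coset_image by (intro inj_on_image_Int) auto
    also have "a <# ((inv a \<otimes> b) <# F) = b <# F"
      using ab F by (simp add: lcos_m_assoc m_assoc [symmetric])
    finally show ?thesis ..
  qed
  also have "card \<dots> = card (F \<inter> ((inv a \<otimes> b) <# F))"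
    using ab F by (intro card_l_coset) auto
  also have "\<dots> \<le> 1" using sidon ne ab by simp
  finally show ?thesis .
qed

lemma card_translates_3_ge:
  assumes sidon: "\<forall>g\<in>carrier G. g \<noteq> \<one> \<longrightarrow> card (F \<inter> (g <# F)) \<le> 1"
    and F: "F \<subseteq> carrier G" and L: "L \<subseteq> carrier G" "3 \<le> card L"
  shows "3 * card F \<le> card (L <#> F) + 3"
proof -
  obtain a b c where abc: "a \<in> L" "b \<in> L" "c \<in> L" "a \<noteq> b" "a \<noteq> c" "b \<noteq> c"
  proof -
    obtain T where "T \<subseteq> L" "card T = 3"
      using obtain_subset_with_card_n[OF L(2)] by blast
    then show ?thesis by (auto simp: card_3_iff intro: that)
  qed
  let ?A = "a <# F" and ?B = "b <# F" and ?C = "c <# F"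
  have G: "a \<in> carrier G" "b \<in> carrier G" "c \<in> carrier G" using abc L by auto
  have fin: "finite ?A" "finite ?B" "finite ?C"
    using F by (auto simp: l_coset_image finite_subset_carrier)
  have "card ?A + card ?B = card (?A \<union> ?B) + card (?A \<inter> ?B)"
    "card (?A \<union> ?B) + card ?C = card (?A \<union> ?B \<union> ?C) + card ((?A \<inter> ?C) \<union> (?B \<inter> ?C))"
    using fin card_Un_Int[of ?A ?B] card_Un_Int[of "?A \<union> ?B" ?C] by (auto simp: Int_Un_distrib2)
  moreover have "card ((?A \<inter> ?C) \<union> (?B \<inter> ?C)) \<le> card (?A \<inter> ?C) + card (?B \<inter> ?C)"
    by (rule card_Un_le)
  moreover have "card (?A \<inter> ?B) \<le> 1" "card (?A \<inter> ?C) \<le> 1" "card (?B \<inter> ?C) \<le> 1"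
    using card_Int_translates_le[OF sidon F] G abc by auto
  moreover have "card ?A = card F" "card ?B = card F" "card ?C = card F"
    using G F by auto
  moreover have "card (?A \<union> ?B \<union> ?C) \<le> card (L <#> F)"
    using abc L F by (intro card_mono Un_least) (auto simp: l_coset_image intro: mem_set_mult)
  ultimately show ?thesis by linarith
qed

lemma card_translates_2_ge:
  assumes sidon: "\<forall>g\<in>carrier G. g \<noteq> \<one> \<longrightarrow> card (F \<inter> (g <# F)) \<le> 1"
    and F: "F \<subseteq> carrier G" and L: "L \<subseteq> carrier G" "2 \<le> card L"
  shows "2 * card F \<le> card (L <#> F) + 1"
proof -
  obtain a b where abc: "a \<in> L" "b \<in> L" "a \<noteq> b"
  proof -
    obtain T where "T \<subseteq> L" "card T = 2"
      using obtain_subset_with_card_n[OF L(2)] by blast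
    then show ?thesis by (auto simp: card_2_iff intro: that)
  qed
  let ?A = "a <# F" and ?B = "b <# F"
  have G: "a \<in> carrier G" "b \<in> carrier G" using abc L by auto
  have fin: "finite ?A" "finite ?B"
    using F by (auto simp: l_coset_image finite_subset_carrier)
  have "card ?A + card ?B = card (?A \<union> ?B) + card (?A \<inter> ?B)"
    using fin card_Un_Int[of ?A ?B] by simp
  moreover have "card (?A \<inter> ?B) \<le> 1"
    using card_Int_translates_le[OF sidon F] G abc by auto
  moreover have "card ?A = card F" "card ?B = card F"
    using G F by auto
  moreover have "card (?A \<union> ?B) \<le> card (L <#> F)"
    using abc L F by (intro card_mono Un_least) (auto simp: l_coset_image intro: mem_set_mult)
  ultimately show ?thesis by linarith
qed

text \<open>
  Let \<open>F\<close> be a \<open>2\<close>-atom of \<open>S\<close> through \<open>\<one>\<close>. If \<open>F\<close> generates a proper subgroup, then this subgroup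
  contains a suitable \<open>N\<close>. If \<open>F\<close> generates the group, then it is not a subgroup, as it is not the
  whole group, and hence a Sidon set. The claim is then that \<open>F\<close> has only two elements, which means that
  the group is cyclic. To see this, exchange the roles: \<open>S\<close> shows that \<open>F\<close>, too, has a product
  that is smaller than expected, so let \<open>L\<close> be a \<open>2\<close>-atom of \<open>F\<close>. Two translates of a Sidon set
  overlap so little that \<open>card F \<le> card L\<close>. So \<open>L\<close> is not a subgroup, for a proper subgroup does
  not contain \<open>F\<close> and its size would at least double in \<open>L <#> F\<close>; it is a Sidon set as well and \<open>card L = card F\<close>. Now three translates of \<open>F\<close> already have more elements than
  \<open>L <#> F\<close> may have, unless \<open>card F = 2\<close>.
\<close>

lemma cyclic_or_critical_subgroup:
  assumes S: "S \<subseteq> carrier G" "2 \<le> card S" and T: "T \<subseteq> carrier G" "2 \<le> card T"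
    and critical: "card (T <#> S) < card T + card S" and room: "card (T <#> S) + 2 \<le> order G"
  shows "(\<exists>g\<in>carrier G. generate G {g} = carrier G) \<or>
    (\<exists>N. subgroup N G \<and> N \<noteq> {\<one>} \<and> N \<noteq> carrier G \<and> card (N <#> S) < card N + card S)"
proof -
  have "admissible 2 S T"
    using T room by (simp add: admissible_def)
  then obtain F where F: "atom 2 S F" "\<one> \<in> F" "excess S F \<le> excess S T"
    using exists_atom S by fastforce
  have FG: "F \<subseteq> carrier G" "2 \<le> card F" "card (F <#> S) + 2 \<le> order G"
    using F by (auto simp: atom_def fragment_def admissible_def)
  have small: "excess S F < int (card S)"
    using F(3) critical by (simp add: excess_def)
  show ?thesis
  proof (cases "generate G F = carrier G")
    case False
    have "\<exists>P. subgroup P G \<and> P \<subseteq> generate G F \<and> P \<noteq> {\<one>} \<and> excess S P < int (card S)"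
      by (rule exists_subgroup_of_small_excess)
        (use FG F small S in \<open>auto intro: generate_is_subgroup generate.incl\<close>)
    then obtain P where P: "subgroup P G" "P \<subseteq> generate G F" "P \<noteq> {\<one>}" "excess S P < int (card S)"
      by blast
    moreover have "P \<noteq> carrier G"
      using P(2) False generate_incl[OF FG(1)] by blast
    ultimately show ?thesis
      by (auto simp: excess_def)
  next
    case gen: True
    have not_sub: "\<not> F \<subseteq> P" if P: "subgroup P G" "P \<noteq> carrier G" for P
      using generate_subgroup_incl[OF _ P(1), of F] gen P subgroup.subset[OF P(1)] by blast
    have S_ne: "S \<noteq> {}" using S by auto
    have lt: "card (F <#> S) < order G" "card F < order G"
      using FG card_set_mult_ge[OF FG(1) S(1) S_ne] by auto
    then have "F \<noteq> carrier G"
      by (auto simp: order_def)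
    then have "\<not> subgroup F G"
      using not_sub by blast
    then have sidonF: "\<forall>g\<in>carrier G. g \<noteq> \<one> \<longrightarrow> card (F \<inter> (g <# F)) \<le> 1"
      using atom_2_subgroup_or_sidon F S by blast
    have "card F = 2"
    proof (rule ccontr)
      assume "card F \<noteq> 2"
      then have F3: "3 \<le> card F" using FG by simp
      have "admissible 2 F S"
        using S FG by (simp add: admissible_def set_mult_comm[of S F])
      then obtain L where L: "atom 2 F L" "\<one> \<in> L" "excess F L \<le> excess F S"
        using exists_atom FG by fastforce
      have LG: "L \<subseteq> carrier G" "2 \<le> card L" "card (L <#> F) + 2 \<le> order G"
        using L by (auto simp: atom_def fragment_def admissible_def)
      have LF: "card (L <#> F) < card L + card F"
        using L(3) small S FG by (simp add: excess_def set_mult_comm[of S F])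
      have ge: "card F \<le> card L"
        using card_translates_2_ge[OF sidonF FG(1) LG(1,2)] LF by linarith
      have "F \<noteq> {}" using FG by auto
      then have "card L < order G"
        using LG card_set_mult_ge[OF LG(1) FG(1)] by simp
      then have "L \<noteq> carrier G"
        by (auto simp: order_def)
      have "\<not> subgroup L G"
      proof
        assume L': "subgroup L G"
        then have "2 * card L \<le> card (L <#> F)"
          using card_subgroup_set_mult_ge[OF L' FG(1) F(2)] not_sub \<open>L \<noteq> carrier G\<close> by blast
        then show False using LF ge by linarith
      qed
      then have sidonL: "\<forall>g\<in>carrier G. g \<noteq> \<one> \<longrightarrow> card (L \<inter> (g <# L)) \<le> 1"
        using atom_2_subgroup_or_sidon L FG by blast
      have "card L \<le> card F"
        using card_translates_2_ge[OF sidonL LG(1) FG(1,2)] LF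
        by (simp add: set_mult_comm[OF FG(1) LG(1)])
      moreover have "3 * card F \<le> card (L <#> F) + 3"
        using card_translates_3_ge[OF sidonF FG(1) LG(1)] ge F3 by simp
      ultimately show False using LF F3 ge by linarith
    qed
    moreover have "finite F" using FG finite_subset_carrier by blast
    ultimately have "card (F - {\<one>}) = 1" using F(2) by simp
    then obtain g where g: "F - {\<one>} = {g}"
      by (rule card_1_singletonE)
    have gG: "g \<in> carrier G" using g FG by blast
    have sub: "subgroup (generate G {g}) G" using gG by (intro generate_is_subgroup) auto
    have "g \<in> generate G {g}" by (rule generate.incl) simp
    moreover have "F \<subseteq> {\<one>, g}" using g by blast
    ultimately have "F \<subseteq> generate G {g}"
      using subgroup.one_closed[OF sub] by blast
    then have "generate G {g} = carrier G" using not_sub[OF sub] by blast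
    then show ?thesis using gG by blast
  qed
qed

section \<open>Iterated product sets\<close>

lemma hfold_0 [simp]: "hfold G 0 A = {\<one>}"
  by (auto simp: hfold_def)

lemma hfold_Suc:
  assumes A: "A \<subseteq> carrier G"
  shows "hfold G (Suc h) A = hfold G h A <#> A"
proof (intro subset_antisym subsetI)
  fix x assume "x \<in> hfold G (Suc h) A"
  then obtain f where f: "f \<in> {..<Suc h} \<rightarrow> A" "x = finprod G f {..<Suc h}"
    by (auto simp: hfold_def)
  have fG: "f \<in> {..<h} \<rightarrow> carrier G" "f h \<in> carrier G"
    using f A by (auto simp: Pi_iff)
  then have "x = f h \<otimes> finprod G f {..<h}"
    using f by (simp add: lessThan_Suc)
  also have "\<dots> = finprod G f {..<h} \<otimes> f h"
    using fG by (intro m_comm) auto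
  finally have "x = finprod G f {..<h} \<otimes> f h" .
  moreover have "f \<in> {..<h} \<rightarrow> A" "f h \<in> A"
    using f by auto
  moreover from this have "finprod G f {..<h} \<in> hfold G h A"
    by (auto simp: hfold_def)
  ultimately show "x \<in> hfold G h A <#> A"
    using mem_set_mult by blast
next
  fix x assume "x \<in> hfold G h A <#> A"
  then obtain y a where "y \<in> hfold G h A" and a: "a \<in> A" "x = y \<otimes> a"
    by (rule set_multE)
  then obtain f where f: "f \<in> {..<h} \<rightarrow> A" "y = finprod G f {..<h}"
    by (auto simp: hfold_def)
  have fG: "f \<in> {..<h} \<rightarrow> carrier G" "a \<in> carrier G"
    using f a A by (auto simp: Pi_iff)
  define g where "g = f(h := a)"
  have g: "g \<in> {..<Suc h} \<rightarrow> A"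
    using f a by (auto simp: g_def Pi_iff)
  have "finprod G g {..<h} = y"
    unfolding f(2) using fG by (intro finprod_cong') (auto simp: g_def)
  then have "finprod G g {..<Suc h} = a \<otimes> y"
    using fG g A by (subst lessThan_Suc, subst finprod_insert) (auto simp: g_def Pi_iff)
  also have "\<dots> = x"
    using a f fG by (simp add: m_comm)
  finally show "x \<in> hfold G (Suc h) A"
    using g by (auto simp: hfold_def intro!: exI[of _ g])
qed

lemma hfold_1: "A \<subseteq> carrier G \<Longrightarrow> hfold G (Suc 0) A = A"
  by (simp add: hfold_Suc flip: l_coset_eq_set_mult)

lemma hfold_subset_carrier: "A \<subseteq> carrier G \<Longrightarrow> hfold G h A \<subseteq> carrier G"
  by (induction h) (auto simp: hfold_Suc set_mult_closed)

lemma hfold_mult_mem: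
  "A \<subseteq> carrier G \<Longrightarrow> x \<in> hfold G h A \<Longrightarrow> a \<in> A \<Longrightarrow> x \<otimes> a \<in> hfold G (Suc h) A"
  by (simp add: hfold_Suc mem_set_mult)

lemma pow_mem_hfold:
  "A \<subseteq> carrier G \<Longrightarrow> a \<in> A \<Longrightarrow> a [^] h \<in> hfold G h A"
  by (induction h) (auto intro: hfold_mult_mem)

lemma card_hfold_mono:
  assumes A: "A \<subseteq> carrier G" "A \<noteq> {}" and "i \<le> j"
  shows "card (hfold G i A) \<le> card (hfold G j A)"
  using \<open>i \<le> j\<close>
proof (induction j rule: dec_induct)
  case (step j)
  then show ?case
    using card_set_mult_ge[OF hfold_subset_carrier[OF A(1)] A, of j] A by (simp add: hfold_Suc)
qed simp

text \<open>
  The factor \<open>2\<close> permits the bound \<open>m = card A\<close>, a gain of half the size of \<open>A\<close> at each step.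
\<close>

lemma card_hfold_ge:
  assumes A: "A \<subseteq> carrier G"
    and step: "\<And>j. 1 \<le> j \<Longrightarrow> j < h \<Longrightarrow> m \<le> 2 * excess A (hfold G j A)" and h: "1 \<le> h"
  shows "2 * int (card A) + (int h - 1) * m \<le> 2 * int (card (hfold G h A))"
  using h step
proof (induction h rule: dec_induct)
  case base
  then show ?case using A by (simp add: hfold_1)
next
  case (step j)
  have "m \<le> 2 * excess A (hfold G j A)" using step by simp
  moreover have "2 * int (card A) + (int j - 1) * m \<le> 2 * int (card (hfold G j A))"
    using step by simp
  ultimately show ?case
    using A by (simp add: excess_def hfold_Suc algebra_simps)
qed

section \<open>Sets that nearly fill their cosets\<close>

lemma card_fibre:
  assumes "group_hom G Q \<phi>" and x: "x \<in> carrier G"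
  shows "card {w \<in> carrier G. \<phi> w = \<phi> x} = card (kernel G Q \<phi>)"
proof -
  interpret h: group_hom G Q \<phi> by fact
  have K: "kernel G Q \<phi> \<subseteq> carrier G" by (auto simp: kernel_def)
  have "{w \<in> carrier G. \<phi> w = \<phi> x} = x <# kernel G Q \<phi>"
  proof (intro subset_antisym subsetI)
    fix w assume "w \<in> {w \<in> carrier G. \<phi> w = \<phi> x}"
    then show "w \<in> x <# kernel G Q \<phi>"
      using x K by (subst mem_l_coset_iff) (auto simp: kernel_def)
  next
    fix w assume "w \<in> x <# kernel G Q \<phi>"
    then show "w \<in> {w \<in> carrier G. \<phi> w = \<phi> x}"
      using x by (auto simp: l_coset_image kernel_def)
  qed
  then show ?thesis using x K by simp
qed

text \<open>
  Pigeonhole: for \<open>w\<close> over \<open>a \<otimes> b\<close>, the sets \<open>w \<otimes> inv x\<close>, \<open>x \<in> X\<close>, and \<open>Y\<close> are too large to be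
  disjoint in the fibre over \<open>b\<close>.
\<close>

lemma fibre_product_full:
  assumes Q: "group_hom G Q \<phi>" and ab: "a \<in> carrier G" "b \<in> carrier G"
    and X: "X \<subseteq> {w \<in> carrier G. \<phi> w = \<phi> a}" and Y: "Y \<subseteq> {w \<in> carrier G. \<phi> w = \<phi> b}"
    and large: "card (kernel G Q \<phi>) < card X + card Y"
    and w: "w \<in> carrier G" "\<phi> w = \<phi> (a \<otimes> b)"
  shows "w \<in> X <#> Y"
proof -
  interpret h: group_hom G Q \<phi> by fact
  \<comment> \<open>the possible second factors of \<open>w\<close>\<close>
  define Z where "Z = (\<lambda>x. w \<otimes> inv x) ` X"
  have XG: "X \<subseteq> carrier G" using X by auto
  have "inj_on (\<lambda>x. w \<otimes> inv x) X"
    using XG w by (auto simp: inj_on_def subset_iff)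
  then have card_Z: "card Z = card X" by (simp add: Z_def card_image)
  have Z: "Z \<subseteq> {w \<in> carrier G. \<phi> w = \<phi> b}"
  proof
    fix z assume "z \<in> Z"
    then obtain x where x: "x \<in> X" "z = w \<otimes> inv x" by (auto simp: Z_def)
    have xG: "x \<in> carrier G" "\<phi> x = \<phi> a" using x X by auto
    have "\<phi> w = \<phi> (b \<otimes> a)" using w ab by (simp add: m_comm)
    then have "\<phi> z = \<phi> (b \<otimes> a) \<otimes>\<^bsub>Q\<^esub> inv\<^bsub>Q\<^esub> \<phi> a"
      using x xG w by simp
    also have "\<dots> = \<phi> b" using ab by (simp add: h.H.m_assoc)
    finally show "z \<in> {w \<in> carrier G. \<phi> w = \<phi> b}" using x xG w by auto
  qed
  have "Z \<inter> Y \<noteq> {}"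
  proof
    assume "Z \<inter> Y = {}"
    then have "card Z + card Y = card (Z \<union> Y)"
      using Z Y by (intro card_Un_disjoint [symmetric]) (auto intro: finite_subset)
    also have "\<dots> \<le> card {w \<in> carrier G. \<phi> w = \<phi> b}"
      using Z Y by (intro card_mono) auto
    finally show False using card_fibre[OF Q ab(2)] large card_Z by simp
  qed
  then obtain x where x: "x \<in> X" "w \<otimes> inv x \<in> Y" by (auto simp: Z_def)
  have xG: "x \<in> carrier G" using x XG by blast
  have "x \<otimes> (w \<otimes> inv x) = w \<otimes> (x \<otimes> inv x)"
    using xG w by (intro m_lcomm) auto
  also have "\<dots> = w" using xG w by simp
  finally show ?thesis using mem_set_mult[OF x] by simp
qed

text \<open>
  The elements missing in all the fibres that meet \<open>A\<close> number less than the size of one fibre.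
\<close>

lemma two_fibres_large:
  assumes Q: "group_hom G Q \<phi>" and A: "A \<subseteq> carrier G" and ab: "a \<in> A" "b \<in> A" "\<phi> a \<noteq> \<phi> b"
    and small: "card (kernel G Q \<phi> <#> A) < card (kernel G Q \<phi>) + card A"
  shows "card (kernel G Q \<phi>) < card {w \<in> A. \<phi> w = \<phi> a} + card {w \<in> A. \<phi> w = \<phi> b}"
proof -
  interpret h: group_hom G Q \<phi> by fact
  let ?N = "kernel G Q \<phi>"
  let ?F = "\<lambda>x. {w \<in> carrier G. \<phi> w = \<phi> x}" and ?P = "\<lambda>x. {w \<in> A. \<phi> w = \<phi> x}"
  let ?R = "A - ?P a - ?P b"
  have N: "?N \<subseteq> carrier G" by (auto simp: kernel_def)
  have F_sub: "?F x \<subseteq> ?N <#> A" if "x \<in> A" for x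
  proof
    fix w assume w: "w \<in> ?F x"
    have xG: "x \<in> carrier G" using that A by blast
    have "w = (w \<otimes> inv x) \<otimes> x" "w \<otimes> inv x \<in> ?N"
      using w xG by (auto simp: kernel_def m_assoc)
    then show "w \<in> ?N <#> A" using that mem_set_mult by metis
  qed
  have fin: "finite A" using A finite_subset_carrier by blast
  have AN: "A \<subseteq> ?N <#> A" using F_sub A by blast
  have "card (?F a) + card (?F b) + card ?R = card (?F a \<union> ?F b) + card ?R"
    using ab by (subst card_Un_disjoint) auto
  also have "\<dots> = card (?F a \<union> ?F b \<union> ?R)"
    using fin by (subst card_Un_disjoint [symmetric]) auto
  also have "\<dots> \<le> card (?N <#> A)"
    using F_sub ab AN A N by (intro card_mono Un_least) auto
  also have "\<dots> < card ?N + card A" by (rule small)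
  finally have "card ?N + card ?R < card A"
    using card_fibre[OF Q] ab A by (simp add: subset_iff)
  moreover have "card A = card (?P a \<union> ?P b \<union> ?R)"
    by (rule arg_cong[where f = card]) auto
  moreover have "card (?P a \<union> ?P b \<union> ?R) \<le> card (?P a) + card (?P b) + card ?R"
    by (meson card_Un_le add_le_mono1 order_trans)
  ultimately show ?thesis by linarith
qed

text \<open>
  The map \<open>\<phi>\<close> stands for the projection to a quotient and its fibres for the cosets. Products of
  elements of \<open>A\<close> that are not all from the same fibre fill a whole fibre. So if a fibre contains
  elements of both product sets, it can avoid a common element only if each of them arises from a
  single fibre of \<open>A\<close>, say over \<open>\<phi> a\<close> and \<open>\<phi> b\<close>. If these fibres differ, then the two product sets
  are together too large for the fibre in which they meet. If they agree, then the \<open>k\<close>-th and the \<open>l\<close>-th power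
  of \<open>\<phi> a\<close> are equal; replacing one factor by an element \<open>z\<close> of another fibre yields a
  fibre that lies in the \<open>k\<close>-fold product set and meets the \<open>l\<close>-fold one.
\<close>

lemma nearly_periodic_sum_free:
  assumes Q: "group_hom G Q \<phi>" and A: "A \<subseteq> carrier G"
    and small: "card (kernel G Q \<phi> <#> A) < card (kernel G Q \<phi>) + card A"
    and spread: "\<And>a. a \<in> A \<Longrightarrow> \<exists>z\<in>A. \<phi> z \<noteq> \<phi> a"
    and disj: "hfold G k A \<inter> hfold G l A = {}" and kl: "0 < l" "l < k"
    and x: "x \<in> hfold G k A" and y: "y \<in> hfold G l A"
  shows "\<phi> x \<noteq> \<phi> y"
proof
  assume xy: "\<phi> x = \<phi> y"
  interpret h: group_hom G Q \<phi> by fact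
  let ?P = "\<lambda>x. {w \<in> A. \<phi> w = \<phi> x}"
  have AG: "a \<in> carrier G" if "a \<in> A" for a using that A by blast
  have foldG: "w \<in> carrier G" if "w \<in> hfold G h A" for w h
    using that hfold_subset_carrier[OF A] by blast
  \<comment> \<open>two factors from different fibres fill a fibre\<close>
  have mixed: "w \<in> hfold G (Suc (Suc h)) A"
    if ab: "a \<in> A" "b \<in> A" "\<phi> a \<noteq> \<phi> b" and w: "w \<in> carrier G" "\<phi> w = \<phi> (a [^] h \<otimes> (a \<otimes> b))"
    for a b w h
  proof -
    have G: "a \<in> carrier G" "b \<in> carrier G" "a [^] h \<in> carrier G" using ab AG by auto
    define u where "u = inv (a [^] h) \<otimes> w"
    have uG: "u \<in> carrier G" using w G by (simp add: u_def)
    have wu: "w = a [^] h \<otimes> u"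
      using w G by (simp add: u_def m_assoc [symmetric])
    have "\<phi> u = \<phi> (a \<otimes> b)"
      using w(2) G uG unfolding wu by simp
    then have "u \<in> ?P a <#> ?P b"
      using A uG G two_fibres_large[OF Q A ab small]
      by (intro fibre_product_full[OF Q G(1,2)]) auto
    then obtain a' b' where u: "a' \<in> A" "b' \<in> A" "u = a' \<otimes> b'"
      by (auto elim!: set_multE)
    have "w = a [^] h \<otimes> a' \<otimes> b'"
      using u wu G AG by (simp add: m_assoc)
    then show ?thesis
      using u ab by (auto intro!: hfold_mult_mem A pow_mem_hfold)
  qed
  \<comment> \<open>A product whose fibre is not filled has all its factors in one fibre.\<close>
  have dichotomy: "(\<forall>w\<in>carrier G. \<phi> w = \<phi> x \<longrightarrow> w \<in> hfold G (Suc h) A) \<or> (\<exists>a\<in>A. \<phi> x = \<phi> (a [^] Suc h))"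
    if "x \<in> hfold G (Suc h) A" for x h
    using that
  proof (induction h arbitrary: x)
    case 0
    then show ?case using A AG by (auto simp: hfold_1)
  next
    case (Suc h)
    then obtain x' b where x': "x' \<in> hfold G (Suc h) A" and b: "b \<in> A" and x: "x = x' \<otimes> b"
      using hfold_Suc[OF A, of "Suc h"] by (auto elim!: set_multE)
    have G: "x' \<in> carrier G" "b \<in> carrier G" using foldG[OF x'] AG b by auto
    from Suc.IH[OF x'] show ?case
    proof
      assume full: "\<forall>w\<in>carrier G. \<phi> w = \<phi> x' \<longrightarrow> w \<in> hfold G (Suc h) A"
      have "w \<in> hfold G (Suc (Suc h)) A" if w: "w \<in> carrier G" "\<phi> w = \<phi> x" for w
      proof -
        have "\<phi> (w \<otimes> inv b) = \<phi> x'"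
          using w G by (simp add: x h.H.m_assoc)
        then have "w \<otimes> inv b \<in> hfold G (Suc h) A"
          using full w G by simp
        then have "w \<otimes> inv b \<otimes> b \<in> hfold G (Suc (Suc h)) A"
          using b by (rule hfold_mult_mem[OF A])
        then show ?thesis using w G by (simp add: m_assoc)
      qed
      then show ?thesis by blast
    next
      assume "\<exists>a\<in>A. \<phi> x' = \<phi> (a [^] Suc h)"
      then obtain a where a: "a \<in> A" "\<phi> x' = \<phi> (a [^] Suc h)" by blast
      have aG: "a \<in> carrier G" using a AG by blast
      show ?thesis
      proof (cases "\<phi> a = \<phi> b")
        case True
        then have "\<phi> x = \<phi> (a [^] Suc (Suc h))"
          using a aG G by (simp add: x)
        then show ?thesis using a by blast
      next
        case False
        have "\<phi> x = \<phi> (a [^] h \<otimes> (a \<otimes> b))"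
          using a aG G by (simp add: x h.H.m_assoc)
        then show ?thesis using mixed[OF a(1) b False] by metis
      qed
    qed
  qed
  obtain k' where k': "k = Suc (Suc k')" using kl by (metis Suc_lessE less_imp_Suc_add)
  obtain l' where l': "l = Suc l'" using kl by (metis gr0_conv_Suc)
  have xG: "x \<in> carrier G" and yG: "y \<in> carrier G" using x y foldG by auto
  obtain a where a: "a \<in> A" "\<phi> x = \<phi> (a [^] k)"
    using dichotomy[of x "Suc k'"] x y yG xy disj unfolding k' by auto
  obtain b where b: "b \<in> A" "\<phi> y = \<phi> (b [^] l)"
    using dichotomy[of y l'] x y xG xy disj unfolding l' by auto
  have G: "a \<in> carrier G" "b \<in> carrier G" using a b AG by auto
  show False
  proof (cases "\<phi> a = \<phi> b")
    case False
    let ?X = "(a [^] Suc k') <# ?P a" and ?Y = "(b [^] l') <# ?P b"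
    have X: "?X \<subseteq> hfold G k A \<inter> {w \<in> carrier G. \<phi> w = \<phi> x}"
      using G a AG A by (auto simp: l_coset_image k' simp del: nat_pow_Suc intro!: hfold_mult_mem pow_mem_hfold)
    have Y: "?Y \<subseteq> hfold G l A \<inter> {w \<in> carrier G. \<phi> w = \<phi> x}"
      using G b AG A xy by (auto simp: l_coset_image l' intro!: hfold_mult_mem pow_mem_hfold)
    have "card ?X + card ?Y = card (?X \<union> ?Y)"
      using X Y disj by (intro card_Un_disjoint [symmetric]) (auto intro: finite_subset)
    also have "\<dots> \<le> card {w \<in> carrier G. \<phi> w = \<phi> x}"
      using X Y by (intro card_mono) auto
    also have "\<dots> = card (kernel G Q \<phi>)" by (rule card_fibre[OF Q xG])
    also have "\<dots> < card (?P a) + card (?P b)"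
      by (rule two_fibres_large[OF Q A a(1) b(1) False small])
    also have "\<dots> = card ?X + card ?Y"
      using G A by (subst (1 2) card_l_coset) auto
    finally show False by simp
  next
    case True
    obtain z where z: "z \<in> A" "\<phi> z \<noteq> \<phi> a" using spread a by blast
    have zG: "z \<in> carrier G" using z AG by blast
    have "\<phi> (a [^] l) = \<phi> (b [^] l)"
      using True G by (simp add: h.hom_nat_pow)
    then have "\<phi> (a [^] Suc k' \<otimes> a) = \<phi> (a [^] l' \<otimes> a)"
      using a(2) b(2) xy by (simp add: k' l')
    then have eq: "\<phi> (a [^] Suc k') = \<phi> (a [^] l')"
      using G h.H.right_cancel[of "\<phi> a" "\<phi> (a [^] Suc k')" "\<phi> (a [^] l')"]
      by (simp del: nat_pow_Suc)
    have u: "a [^] l' \<otimes> z \<in> hfold G l A"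
      using a z by (auto simp: l' intro!: hfold_mult_mem pow_mem_hfold A)
    moreover have "a [^] l' \<otimes> z \<in> hfold G k A"
      unfolding k'
    proof (rule mixed[OF a(1) z(1)])
      show "\<phi> (a [^] l' \<otimes> z) = \<phi> (a [^] k' \<otimes> (a \<otimes> z))"
        using G zG eq[symmetric] by (simp add: h.H.m_assoc)
    qed (use z G zG in auto)
    ultimately show False using disj by blast
  qed
qed

section \<open>Quotients\<close>

lemma quotient_hom:
  assumes "subgroup N G"
  shows "group_hom G (G Mod N) ((#>) N)" "finite_abelian_group (G Mod N)"
proof -
  interpret N: normal N G using assms by (rule subgroup_imp_normal)
  show hom: "group_hom G (G Mod N) ((#>) N)"
    by (simp add: group_hom_def group_hom_axioms_def is_group N.factorgroup_is_group N.r_coset_hom_Mod)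
  have "comm_group (G Mod N)"
    using assms by (rule abelian_FactGroup)
  then show "finite_abelian_group (G Mod N)"
    by (simp add: finite_abelian_group_def finite_abelian_group_axioms_def carrier_FactGroup)
qed

lemma r_coset_eq_iff:
  assumes N: "subgroup N G" and "x \<in> carrier G" "y \<in> carrier G"
  shows "N #> x = N #> y \<longleftrightarrow> x \<otimes> inv y \<in> N"
  using assms subgroup.rcos_module[OF N is_group assms(3,2)] rcos_self[OF assms(2) N]
    repr_independence[OF _ assms(3) N, of x] by auto

lemma r_coset_eq_one_iff:
  assumes N: "subgroup N G" and "x \<in> carrier G"
  shows "N #> x = N \<longleftrightarrow> x \<in> N"
  using assms r_coset_eq_iff[OF N assms(2) one_closed] subgroup.subset[OF N] by simp

lemma subgroup_preimage:
  assumes N: "subgroup N G" and P: "subgroup P (G Mod N)"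
  shows "subgroup {x \<in> carrier G. N #> x \<in> P} G" and "N \<subseteq> {x \<in> carrier G. N #> x \<in> P}"
    and "{x \<in> carrier G. N #> x \<in> P} \<subseteq> N \<Longrightarrow> P = {N}"
proof -
  interpret h: group_hom G "G Mod N" "(#>) N" by (rule quotient_hom[OF N])
  note NG = subgroup.subset[OF N]
  have one: "N \<in> P" using subgroup.one_closed[OF P] by simp
  show "subgroup {x \<in> carrier G. N #> x \<in> P} G"
  proof (rule subgroup_if_division_closed)
    show "{x \<in> carrier G. N #> x \<in> P} \<noteq> {}"
      using one NG by (auto intro!: exI[of _ \<one>])
    fix x y assume "x \<in> {x \<in> carrier G. N #> x \<in> P}" "y \<in> {x \<in> carrier G. N #> x \<in> P}"
    then show "inv x \<otimes> y \<in> {x \<in> carrier G. N #> x \<in> P}"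
      using subgroup.m_closed[OF P] subgroup.m_inv_closed[OF P]
      by (simp del: mult_FactGroup)
  qed auto
  show "N \<subseteq> {x \<in> carrier G. N #> x \<in> P}"
  proof
    fix x assume x: "x \<in> N"
    then have "x \<in> carrier G" using NG by blast
    then show "x \<in> {x \<in> carrier G. N #> x \<in> P}"
      using one x r_coset_eq_one_iff[OF N, of x] by simp
  qed
  show "P = {N}" if sub: "{x \<in> carrier G. N #> x \<in> P} \<subseteq> N"
  proof -
    have "X = N" if "X \<in> P" for X
    proof -
      have "X \<in> carrier (G Mod N)" using that subgroup.subset[OF P] by blast
      then obtain x where x: "x \<in> carrier G" "X = N #> x" by (auto simp: carrier_FactGroup)
      then show ?thesis using sub that r_coset_eq_one_iff[OF N x(1)] by auto
    qed
    then show ?thesis using one by blast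
  qed
qed

section \<open>Dense sum-free sets\<close>

lemma set_mult_l_coset:
  assumes "a \<in> carrier G" "X \<subseteq> carrier G" "S \<subseteq> carrier G"
  shows "X <#> (a <# S) = a <# (X <#> S)"
proof -
  have "X <#> (a <# S) = (a <# S) <#> X"
    using assms by (intro set_mult_comm l_coset_subset_G)
  also have "\<dots> = a <# (S <#> X)"
    using assms by (intro l_coset_set_mult)
  finally show ?thesis using assms by (simp add: set_mult_comm)
qed

text \<open>
  The bound of Olson for sets that need not contain \<open>\<one>\<close>: after a translation, \<open>S\<close> and \<open>T\<close> lie in
  the subgroup \<open>M\<close>, in which \<open>S\<close> is generating.
\<close>

lemma excess_ge_half_coset:
  assumes M: "subgroup M G" and a: "a \<in> carrier G" and S: "a \<in> S" "S \<subseteq> a <# M"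
    and gen: "\<And>P. subgroup P G \<Longrightarrow> S \<subseteq> a <# P \<Longrightarrow> M \<subseteq> P"
    and b: "b \<in> carrier G" and T: "T \<subseteq> b <# M" "T \<noteq> {}" "T <#> S \<noteq> (a \<otimes> b) <# M"
  shows "int (card S) \<le> 2 * excess S T"
proof -
  have MG: "M \<subseteq> carrier G" using M by (rule subgroup.subset)
  have SG: "S \<subseteq> carrier G" and TG: "T \<subseteq> carrier G"
    using S T l_coset_subset_G[OF MG] a b by blast+
  have "comm_group (G\<lparr>carrier := M\<rparr>)"
    by (rule group.group_comm_groupI[OF subgroup_imp_group[OF M]]) (use MG in \<open>auto intro: m_comm\<close>)
  then interpret M: finite_abelian_group "G\<lparr>carrier := M\<rparr>"
    using MG by (simp add: finite_abelian_group_def finite_abelian_group_axioms_def finite_subset_carrier)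
  have shift: "X \<subseteq> c <# Y \<longleftrightarrow> inv c <# X \<subseteq> Y"
    if "c \<in> carrier G" "X \<subseteq> carrier G" "Y \<subseteq> carrier G" for c X Y
    using that by (auto simp: l_coset_image mem_l_coset_iff[unfolded l_coset_image] subset_iff)
  let ?S = "inv a <# S" and ?T = "inv b <# T"
  have exc: "M.excess ?S ?T = excess S T"
    using a b SG TG
    by (simp add: M.excess_def excess_def l_coset_set_mult set_mult_l_coset l_coset_subset_G set_mult_closed)
  have "int (card ?S) \<le> 2 * M.excess ?S ?T"
  proof (rule M.excess_ge_half)
    show "?S \<subseteq> carrier (G\<lparr>carrier := M\<rparr>)" "?T \<subseteq> carrier (G\<lparr>carrier := M\<rparr>)"
      using shift[OF a SG MG] shift[OF b TG MG] S T by auto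
    show "\<one>\<^bsub>G\<lparr>carrier := M\<rparr>\<^esub> \<in> ?S"
      using a S(1) SG by (auto simp: mem_l_coset_iff)
    show "?T \<noteq> {}" using T by (auto simp: l_coset_image)
    show "P = carrier (G\<lparr>carrier := M\<rparr>)" if P: "subgroup P (G\<lparr>carrier := M\<rparr>)" "?S \<subseteq> P" for P
    proof -
      have "subgroup P G" by (rule incl_subgroup[OF M P(1)])
      moreover have "P \<subseteq> M" using subgroup.subset[OF P(1)] by simp
      moreover have "S \<subseteq> a <# P"
        using shift[OF a SG, of P] P(2) \<open>P \<subseteq> M\<close> MG by blast
      ultimately show ?thesis using gen[of P] by auto
    qed
    show "?T <#>\<^bsub>G\<lparr>carrier := M\<rparr>\<^esub> ?S \<noteq> carrier (G\<lparr>carrier := M\<rparr>)"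
    proof
      assume "?T <#>\<^bsub>G\<lparr>carrier := M\<rparr>\<^esub> ?S = carrier (G\<lparr>carrier := M\<rparr>)"
      then have "inv a <# (inv b <# (T <#> S)) = M"
        using a b SG TG by (simp add: l_coset_set_mult set_mult_l_coset l_coset_subset_G)
      then have "(inv a \<otimes> inv b) <# (T <#> S) = M"
        using a b SG TG by (simp add: lcos_m_assoc set_mult_closed)
      then have "(a \<otimes> b) <# ((inv a \<otimes> inv b) <# (T <#> S)) = (a \<otimes> b) <# M" by simp
      moreover have "(a \<otimes> b) \<otimes> (inv a \<otimes> inv b) = \<one>"
        using a b by (simp flip: inv_mult)
      ultimately have "T <#> S = (a \<otimes> b) <# M"
        using a b SG TG by (simp add: lcos_m_assoc set_mult_closed)
      then show False using T(3) by simp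
    qed
  qed
  then show ?thesis using exc a SG by simp
qed

lemma hfold_subset_coset:
  assumes M: "subgroup M G" and a: "a \<in> carrier G" and A: "A \<subseteq> a <# M"
  shows "hfold G h A \<subseteq> (a [^] h) <# M"
proof (induction h)
  case 0
  then show ?case using subgroup.one_closed[OF M] subgroup.subset[OF M] by simp
next
  case (Suc h)
  have MG: "M \<subseteq> carrier G" using M by (rule subgroup.subset)
  have AG: "A \<subseteq> carrier G" using A l_coset_subset_G[OF MG a] by blast
  have aM: "a <# M \<subseteq> carrier G" "(a [^] h) <# M \<subseteq> carrier G"
    using l_coset_subset_G[OF MG] a by auto
  have "hfold G (Suc h) A \<subseteq> ((a [^] h) <# M) <#> (a <# M)"
    unfolding hfold_Suc[OF AG] by (intro mono_set_mult Suc A)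
  also have "\<dots> = a <# ((a [^] h) <# (M <#> M))"
    using a MG aM by (simp add: l_coset_set_mult set_mult_l_coset)
  also have "\<dots> = (a [^] Suc h) <# M"
    using a MG by (simp add: subgroup_mult_id[OF M] lcos_m_assoc m_comm)
  finally show ?case .
qed

lemma coset_eq_iff:
  assumes M: "subgroup M G" and "x \<in> carrier G" "y \<in> carrier G"
  shows "x <# M = y <# M \<longleftrightarrow> x \<otimes> inv y \<in> M"
proof -
  have "x <# M = y <# M \<longleftrightarrow> x \<in> y <# M"
    using assms l_repr_independence[OF _ assms(3) M, of x] subgroup.one_closed[OF M]
      mem_l_coset_iff[OF assms(2) subgroup.subset[OF M] assms(2)] by auto
  also have "\<dots> \<longleftrightarrow> x \<otimes> inv y \<in> M"
    using assms subgroup.subset[OF M] by (simp add: mem_l_coset_iff m_comm)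
  finally show ?thesis .
qed

text \<open>
  A growth by \<open>card A\<close> at every step would make the \<open>h\<close>-fold product set too large.
\<close>

lemma slow_growth:
  assumes A: "A \<subseteq> carrier G" and h: "1 \<le> h" and small: "card (hfold G h A) < h * card A"
  shows "\<exists>j\<ge>1. j < h \<and> excess A (hfold G j A) < int (card A)"
proof (rule ccontr)
  assume "\<not> ?thesis"
  then have "2 * int (card A) \<le> 2 * excess A (hfold G j A)" if "1 \<le> j" "j < h" for j
    using that by (auto simp: not_less)
  then have "2 * int (card A) + (int h - 1) * (2 * int (card A)) \<le> 2 * int (card (hfold G h A))"
    using A h by (intro card_hfold_ge)
  then have "int h * int (card A) \<le> int (card (hfold G h A))"
    by (simp add: algebra_simps)
  then show False using small by (simp flip: of_nat_mult)
qed

text \<open>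
  Let \<open>M\<close> be generated by the quotients of elements of \<open>A\<close>, so that every \<open>h\<close>-fold product set lies
  in one coset of \<open>M\<close>. If the cosets for \<open>k\<close> and \<open>l\<close> differ, then \<open>N = M\<close> will do. If they agree
  and \<open>M\<close> is a proper subgroup, then the bound of Olson contradicts the density of \<open>A\<close>. If \<open>M\<close> is
  the whole group, then the density yields a step of slow growth and thus a critical subgroup.
\<close>

lemma dense_sum_free_cyclic_or_enlarge:
  assumes A: "A \<subseteq> carrier G" and disj: "hfold G k A \<inter> hfold G l A = {}" and kl: "0 < l" "l < k"
    and dense: "order G < (k + l) * card A"
  shows "(\<exists>y\<in>carrier G. A \<subseteq> generate G {y}) \<or>
    (\<exists>N. subgroup N G \<and> N \<noteq> {\<one>} \<and> (\<forall>x\<in>hfold G k A. \<forall>y\<in>hfold G l A. x \<otimes> inv y \<notin> N))"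
proof -
  have "A \<noteq> {}" using dense by auto
  then obtain a where a: "a \<in> A" by blast
  have aG: "a \<in> carrier G" using a A by blast
  have finA: "finite A" using A finite_subset_carrier by blast
  show ?thesis
  proof (cases "card A = 1")
    case True
    then obtain b where "A = {b}" by (rule card_1_singletonE)
    then have "A = {a}" using a by simp
    then show ?thesis using aG generate.incl[of a "{a}" G] by blast
  next
    case False
    have A2: "2 \<le> card A"
      using False \<open>A \<noteq> {}\<close> finA by (metis One_nat_def Suc_1 Suc_leI card_gt_0_iff le_neq_implies_less)
    define M where "M = generate G (inv a <# A)"
    have aA: "inv a <# A \<subseteq> carrier G" using l_coset_subset_G[OF A] aG by simp
    have M: "subgroup M G" unfolding M_def by (rule generate_is_subgroup[OF aA])
    have MG: "M \<subseteq> carrier G" using M by (rule subgroup.subset)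
    have AM: "A \<subseteq> a <# M"
    proof
      fix x assume x: "x \<in> A"
      then have "inv a \<otimes> x \<in> M"
        unfolding M_def by (intro generate.incl) (auto simp: l_coset_image)
      then show "x \<in> a <# M"
        using x A aG MG by (subst mem_l_coset_iff) auto
    qed
    have gen: "M \<subseteq> P" if P: "subgroup P G" "A \<subseteq> a <# P" for P
      unfolding M_def
    proof (rule generate_subgroup_incl[OF _ P(1)])
      show "inv a <# A \<subseteq> P"
        using P A aG subgroup.subset[OF P(1)]
        by (auto simp: l_coset_image mem_l_coset_iff[unfolded l_coset_image] subset_iff)
    qed
    have folds: "hfold G h A \<subseteq> (a [^] h) <# M" for h
      by (rule hfold_subset_coset[OF M aG AM])
    have fold_ge: "card A \<le> card (hfold G h A)" if "1 \<le> h" for h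
      using card_hfold_mono[OF A \<open>A \<noteq> {}\<close> that] A by (simp add: hfold_1)
    show ?thesis
    proof (cases "(a [^] k) <# M = (a [^] l) <# M")
      case False
      have "x \<otimes> inv y \<notin> M" if x: "x \<in> hfold G k A" and y: "y \<in> hfold G l A" for x y
      proof
        assume "x \<otimes> inv y \<in> M"
        moreover have "x \<in> (a [^] k) <# M" "y \<in> (a [^] l) <# M" using x y folds by auto
        moreover from this have "x \<in> carrier G" "y \<in> carrier G"
          using l_coset_subset_G[OF MG] aG by blast+
        moreover have "(a [^] k) <# M = x <# M" "(a [^] l) <# M = y <# M"
          by (intro l_repr_independence[OF _ _ M] calculation(2,3) nat_pow_closed aG)+
        ultimately have "(a [^] k) <# M = (a [^] l) <# M"
          using coset_eq_iff[OF M, of x y] by simp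
        then show False using False by simp
      qed
      moreover have "M \<noteq> {\<one>}"
      proof
        assume "M = {\<one>}"
        then have "A \<subseteq> {a}" using AM aG by (simp add: l_coset_image)
        then show False using A2 card_mono[of "{a}" A] by simp
      qed
      ultimately show ?thesis using M by blast
    next
      case same: True
      have card_aM: "card ((a [^] h) <# M) = card M" for h :: nat
        using aG MG by simp
      have sum_le: "card (hfold G k A) + card (hfold G l A) \<le> card M"
      proof -
        have "card (hfold G k A) + card (hfold G l A) = card (hfold G k A \<union> hfold G l A)"
          using disj A by (intro card_Un_disjoint [symmetric] finite_subset_carrier hfold_subset_carrier)
        also have "\<dots> \<le> card ((a [^] k) <# M)"
          using folds[of k] folds[of l] same l_coset_subset_G[OF MG] aG
          by (intro card_mono Un_least finite_subset_carrier) auto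
        finally show ?thesis by (simp only: card_aM)
      qed
      have M_le: "card M \<le> order G"
        using MG by (simp add: order_def card_mono)
      show ?thesis
      proof (cases "M = carrier G")
        case False
        \<comment> \<open>At least half of \<open>card A\<close> is gained in each step, since a proper subset of a coset of \<open>M\<close>
            is obtained.\<close>
        have grow: "(int h + 1) * int (card A) \<le> 2 * int (card (hfold G h A))"
          if h: "1 \<le> h" "card (hfold G h A) < card M" for h
        proof -
          have "int (card A) \<le> 2 * excess A (hfold G j A)" if j: "1 \<le> j" "j < h" for j
          proof (rule excess_ge_half_coset[OF M aG a AM gen _ folds])
            show "hfold G j A \<noteq> {}"
              using fold_ge[OF j(1)] A2 by auto
            have "card (hfold G (Suc j) A) < card M"
              using card_hfold_mono[OF A \<open>A \<noteq> {}\<close>, of "Suc j" h] j h by simp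
            then show "hfold G j A <#> A \<noteq> (a \<otimes> (a [^] j)) <# M"
              using aG MG A by (auto simp flip: hfold_Suc)
          qed (use aG in auto)
          then have "2 * int (card A) + (int h - 1) * int (card A) \<le> 2 * int (card (hfold G h A))"
            using A h by (intro card_hfold_ge)
          then show ?thesis by (simp add: algebra_simps)
        qed
        have "card (hfold G k A) < card M" "card (hfold G l A) < card M"
          using sum_le fold_ge[of k] fold_ge[of l] kl A2 by linarith+
        then have "(int k + 1) * int (card A) + (int l + 1) * int (card A) \<le> 2 * int (card M)"
          using grow[of k] grow[of l] kl sum_le by linarith
        moreover have "2 * card M \<le> order G"
        proof -
          have "2 * card M \<le> card (M <#> carrier G)"
            using False MG by (intro card_subgroup_set_mult_ge M) auto
          also have "\<dots> \<le> order G"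
            unfolding order_def using MG by (intro card_mono set_mult_closed) auto
          finally show ?thesis .
        qed
        ultimately have "(int k + int l) * int (card A) \<le> int (order G)"
          by (simp add: algebra_simps)
        then have "(k + l) * card A \<le> order G"
          by (simp flip: of_nat_add of_nat_mult)
        then show ?thesis using dense by simp
      next
        case True
        have "\<exists>h. h \<in> {k, l} \<and> card (hfold G h A) < h * card A"
        proof (rule ccontr)
          assume "\<not> ?thesis"
          then have "k * card A + l * card A \<le> card (hfold G k A) + card (hfold G l A)"
            by (intro add_mono) (auto simp: not_less)
          then show False using sum_le M_le dense by (simp add: algebra_simps)
        qed
        then obtain h where h: "h \<in> {k, l}" "card (hfold G h A) < h * card A" by blast
        have h1: "1 \<le> h" using h kl by auto
        obtain j where j: "1 \<le> j" "j < h" "excess A (hfold G j A) < int (card A)"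
          using slow_growth[OF A h1 h(2)] by blast
        have room: "card (hfold G h A) + 2 \<le> order G"
          using sum_le M_le fold_ge[of k] fold_ge[of l] kl A2 h by auto
        have "(\<exists>g\<in>carrier G. generate G {g} = carrier G) \<or>
          (\<exists>N. subgroup N G \<and> N \<noteq> {\<one>} \<and> N \<noteq> carrier G \<and> card (N <#> A) < card N + card A)"
        proof (rule cyclic_or_critical_subgroup[OF A A2])
          show "hfold G j A \<subseteq> carrier G" by (rule hfold_subset_carrier[OF A])
          show "2 \<le> card (hfold G j A)" using fold_ge[OF j(1)] A2 by simp
          show "card (hfold G j A <#> A) < card (hfold G j A) + card A"
            using j(3) by (simp add: excess_def)
          show "card (hfold G j A <#> A) + 2 \<le> order G"
            using card_hfold_mono[OF A \<open>A \<noteq> {}\<close>, of "Suc j" h] j room A by (simp add: hfold_Suc)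
        qed
        then show ?thesis
        proof
          assume "\<exists>g\<in>carrier G. generate G {g} = carrier G"
          then show ?thesis using A by auto
        next
          assume "\<exists>N. subgroup N G \<and> N \<noteq> {\<one>} \<and> N \<noteq> carrier G \<and> card (N <#> A) < card N + card A"
          then obtain N where N: "subgroup N G" "N \<noteq> {\<one>}" "N \<noteq> carrier G"
            "card (N <#> A) < card N + card A" by blast
          have NG: "N \<subseteq> carrier G" using N(1) by (rule subgroup.subset)
          have Q: "group_hom G (G Mod N) ((#>) N)" by (rule quotient_hom[OF N(1)])
          note eq_iff = r_coset_eq_iff[OF N(1)]
          have ker: "kernel G (G Mod N) ((#>) N) = N"
            using r_coset_eq_one_iff[OF N(1)] NG by (auto simp: kernel_def)
          have "x \<otimes> inv y \<notin> N" if x: "x \<in> hfold G k A" and y: "y \<in> hfold G l A" for x y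
          proof -
            have "N #> x \<noteq> N #> y"
            proof (rule nearly_periodic_sum_free[OF Q A _ _ disj kl x y])
              show "card (kernel G (G Mod N) ((#>) N) <#> A) < card (kernel G (G Mod N) ((#>) N)) + card A"
                unfolding ker by (rule N(4))
              show "\<exists>z\<in>A. N #> z \<noteq> N #> b" if b: "b \<in> A" for b
              proof (rule ccontr)
                assume "\<not> ?thesis"
                then have "N #> z = N #> a" if "z \<in> A" for z using that a by metis
                then have "z \<in> a <# N" if "z \<in> A" for z
                  using that A aG eq_iff[of z a] NG by (subst mem_l_coset_iff) (auto simp: m_comm)
                then have "M \<subseteq> N" using gen[OF N(1)] by blast
                then show False using True N(3) NG by blast
              qed
            qed
            then show ?thesis
              using eq_iff x y hfold_subset_carrier[OF A] by blast
          qed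
          then show ?thesis using N by blast
        qed
      qed
    qed
  qed
qed

section \<open>The exponent\<close>

lemma dvd_ord_mult_coprime:
  assumes a: "a \<in> carrier G" and b: "b \<in> carrier G" and cop: "coprime (ord a) (ord b)"
  shows "ord a * ord b dvd ord (a \<otimes> b)"
proof (rule divides_mult[OF _ _ cop])
  let ?n = "ord (a \<otimes> b)"
  have ab: "(a \<otimes> b) [^] (?n * m) = \<one>" for m
    using a b by (simp add: pow_eq_id)
  have "a [^] (?n * ord b) = (a \<otimes> b) [^] (?n * ord b)"
  proof -
    have "b [^] (?n * ord b) = \<one>" using b by (simp add: pow_eq_id)
    then show ?thesis using a b by (simp add: pow_mult_distrib m_comm)
  qed
  then have "ord a dvd ?n * ord b" using a by (simp add: ab pow_eq_id)
  then show "ord a dvd ?n" using cop by (simp add: coprime_dvd_mult_left_iff)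
  have "b [^] (?n * ord a) = (a \<otimes> b) [^] (?n * ord a)"
  proof -
    have "a [^] (?n * ord a) = \<one>" using a by (simp add: pow_eq_id)
    then show ?thesis using a b by (simp add: pow_mult_distrib m_comm)
  qed
  then have "ord b dvd ?n * ord a" using b by (simp add: ab pow_eq_id)
  then show "ord b dvd ?n" using cop by (simp add: coprime_dvd_mult_left_iff coprime_commute)
qed

lemma exists_ord_eq_exponent: "\<exists>g\<in>carrier G. ord g = group_exponent G"
proof -
  have "group_exponent G \<in> ord ` carrier G"
    unfolding group_exponent_def by (intro Max_in) auto
  then show ?thesis by auto
qed

lemma ord_le_exponent: "x \<in> carrier G \<Longrightarrow> ord x \<le> group_exponent G"
  unfolding group_exponent_def by (intro Max_ge) auto

lemma exponent_pos: "0 < group_exponent G"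
  using ord_ge_1[OF finite_carrier one_closed] ord_le_exponent[OF one_closed] by linarith

text \<open>
  Otherwise some prime \<open>p\<close> has a higher power in \<open>ord x\<close> than in the largest order \<open>ord g\<close>. The
  product of the \<open>p\<close>-part of \<open>x\<close> and the part of \<open>g\<close> prime to \<open>p\<close> then has a larger order than \<open>g\<close>.
\<close>

lemma ord_dvd_exponent:
  assumes x: "x \<in> carrier G"
  shows "ord x dvd group_exponent G"
proof (rule multiplicity_le_imp_dvd)
  let ?v = "group_exponent G"
  show ordx: "ord x \<noteq> 0" using ord_ge_1[OF finite_carrier x] by simp
  fix p :: nat assume p: "prime p"
  obtain g where g: "g \<in> carrier G" "ord g = ?v" using exists_ord_eq_exponent by blast
  let ?i = "multiplicity p (ord x)" and ?j = "multiplicity p ?v"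
  have np: "\<not> is_unit p" using p by auto
  obtain m where m: "ord x = p ^ ?i * m" "\<not> p dvd m"
    using multiplicity_decompose'[OF ordx np] by blast
  obtain w where w: "?v = p ^ ?j * w" "\<not> p dvd w"
    using multiplicity_decompose'[OF _ np, of ?v] exponent_pos by auto
  have m0: "m \<noteq> 0" "w \<noteq> 0" using m w by (metis dvd_0_right)+
  have p0: "p \<noteq> 0" using p by auto
  \<comment> \<open>\<open>a\<close> has order \<open>w\<close>, the part of the exponent prime to \<open>p\<close>, and \<open>b\<close> has order \<open>p ^ ?i\<close>.\<close>
  define a where "a = g [^] (p ^ ?j)"
  define b where "b = x [^] m"
  have G: "a \<in> carrier G" "b \<in> carrier G" using g x by (auto simp: a_def b_def)
  have "?v div p ^ ?j = w"
    using w(1) p0 by (metis nonzero_mult_div_cancel_left power_not_zero)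
  then have "ord a = w"
    unfolding a_def using g p0 by (subst ord_pow) (auto simp: multiplicity_dvd)
  moreover have "ord b = p ^ ?i"
  proof -
    have "m dvd ord x" "ord x div m = p ^ ?i"
      using m(1) m0 by (metis dvd_triv_right, metis nonzero_mult_div_cancel_right)
    then show ?thesis unfolding b_def using x m0 by (subst ord_pow) auto
  qed
  moreover have "coprime w (p ^ ?i)"
    using w p by (metis coprime_commute coprime_power_left_iff prime_imp_coprime)
  ultimately have "w * p ^ ?i dvd ord (a \<otimes> b)"
    using dvd_ord_mult_coprime[OF G] by simp
  moreover have "ord (a \<otimes> b) > 0"
    using ord_ge_1[OF finite_carrier, of "a \<otimes> b"] G by simp
  ultimately have "w * p ^ ?i \<le> ?v"
    using ord_le_exponent[of "a \<otimes> b"] G by (meson dvd_imp_le le_trans m_closed)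
  then have "w * p ^ ?i \<le> w * p ^ ?j"
    using w by (simp add: mult.commute)
  then have "p ^ ?i \<le> p ^ ?j" using m0 by simp
  then show "?i \<le> ?j"
    by (rule power_le_imp_le_exp[OF prime_gt_1_nat[OF p]])
qed

lemma pow_exponent [simp]: "x \<in> carrier G \<Longrightarrow> x [^] group_exponent G = \<one>"
  by (simp add: pow_eq_id ord_dvd_exponent)

section \<open>A cyclic direct factor\<close>

lemma powers_generate:
  assumes "g \<in> carrier G"
  shows "generate G {g} = range (\<lambda>i::int. g [^] i)"
  using generate_pow[OF assms] by auto

text \<open>
  If \<open>y\<close> is not a power of \<open>g\<close>, let \<open>t\<close> be its order modulo the powers of \<open>g\<close>. As \<open>y\<close> is
  annihilated by the order of \<open>g\<close>, the power \<open>y [^] t\<close> is a \<open>t\<close>-th power \<open>(g [^] e) [^] t\<close>. Dividing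
  \<open>y\<close> by \<open>g [^] e\<close> gives an element \<open>z\<close> of order \<open>t\<close> also modulo the powers of \<open>g\<close>, so the
  powers of \<open>z\<close> meet those of \<open>g\<close> trivially.
\<close>

lemma generates_if_no_complement:
  assumes g: "g \<in> carrier G" and exp: "\<And>x. x \<in> carrier G \<Longrightarrow> x [^] ord g = \<one>"
    and meet: "\<And>P. subgroup P G \<Longrightarrow> P \<inter> generate G {g} \<subseteq> {\<one>} \<Longrightarrow> P = {\<one>}"
  shows "generate G {g} = carrier G"
proof (rule ccontr)
  let ?C = "generate G {g}"
  have C: "subgroup ?C G" using g by (intro generate_is_subgroup) auto
  assume "?C \<noteq> carrier G"
  then obtain y where y: "y \<in> carrier G" "y \<notin> ?C" using subgroup.subset[OF C] by blast
  interpret Q: finite_abelian_group "G Mod ?C" by (rule quotient_hom[OF C])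
  interpret h: group_hom G "G Mod ?C" "(#>) ?C" by (rule quotient_hom[OF C])
  let ?y = "?C #> y"
  have yQ: "?y \<in> carrier (G Mod ?C)" using y by simp
  define t where "t = group.ord (G Mod ?C) ?y"
  have t0: "t > 0" using Q.ord_ge_1[OF Q.finite_carrier yQ] by (simp add: t_def)
  have pow_mem: "z [^] (n::nat) \<in> ?C \<longleftrightarrow> group.ord (G Mod ?C) (?C #> z) dvd n" if "z \<in> carrier G" for z n
    using r_coset_eq_one_iff[OF C, of "z [^] n"] that Q.pow_eq_id[of "?C #> z" n]
    by (simp add: h.hom_nat_pow)
  have v0: "ord g > 0" using ord_ge_1[OF finite_carrier g] by simp
  have "t dvd ord g"
    using pow_mem[OF y(1), of "ord g"] exp[OF y(1)] subgroup.one_closed[OF C] by (simp add: t_def)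
  then obtain u where u: "ord g = t * u" by blast
  have u0: "u > 0" using u v0 by (cases u) auto
  have "y [^] t \<in> ?C" using pow_mem[OF y(1), of t] by (simp add: t_def)
  then obtain c :: int where c: "y [^] t = g [^] c"
    using powers_generate[OF g] by auto
  have "g [^] (c * int u) = (y [^] t) [^] u"
    using g c int_pow_pow[of g c "int u"] by (simp add: int_pow_int mult.commute)
  also have "\<dots> = \<one>" using exp[OF y(1)] y u by (simp add: nat_pow_pow)
  finally have "int (t * u) dvd c * int u" using int_pow_eq_id[OF g] u by simp
  then have "int t dvd c" using u0 by simp
  then obtain e where e: "c = int t * e" by blast
  \<comment> \<open>\<open>y\<close> corrected by a power of \<open>g\<close>, so that its order does not drop modulo the powers of \<open>g\<close>\<close>
  define z where "z = y \<otimes> g [^] (- e)"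
  have zG: "z \<in> carrier G" using y g by (simp add: z_def)
  have ge: "g [^] i \<in> ?C" for i :: int using powers_generate[OF g] by auto
  have "z [^] t = y [^] t \<otimes> (g [^] (- e)) [^] t"
    using y g by (simp add: z_def pow_mult_distrib m_comm)
  also have "(g [^] (- e)) [^] t = g [^] (- c)"
    using g e int_pow_pow[of g "- e" "int t"] by (simp add: int_pow_int mult.commute)
  also have "y [^] t \<otimes> g [^] (- c) = \<one>"
    using c g by (simp add: int_pow_neg)
  finally have zt: "z [^] t = \<one>" .
  have Cz: "?C #> z = ?C #> y"
    using r_coset_eq_iff[OF C zG y(1)] y g ge by (simp add: z_def m_comm m_assoc [symmetric])
  have "generate G {z} = {\<one>}"
  proof (rule meet)
    show "subgroup (generate G {z}) G" using zG by (intro generate_is_subgroup) auto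
    show "generate G {z} \<inter> ?C \<subseteq> {\<one>}"
    proof
      fix x assume x: "x \<in> generate G {z} \<inter> ?C"
      then obtain n :: nat where n: "x = z [^] n"
        using generate_pow_on_finite_carrier[OF finite_carrier zG] by auto
      then have "t dvd n" using x pow_mem[OF zG, of n] by (simp add: Cz t_def)
      then have "x = \<one>" using n zt zG by (metis dvdE nat_pow_one nat_pow_pow)
      then show "x \<in> {\<one>}" by simp
    qed
  qed
  then have "z = \<one>" using generate.incl[of z "{z}" G] by auto
  then have "?C #> y = ?C" using Cz subgroup.subset[OF C] by simp
  then show False using y r_coset_eq_one_iff[OF C] by simp
qed

text \<open>
  A subgroup \<open>N\<close> of largest size that meets the powers of \<open>g\<close> trivially will do: in the quotient by
  \<open>N\<close>, no subgroup but the trivial one meets the powers of \<open>g\<close> trivially.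
\<close>

lemma exists_complement:
  assumes g: "g \<in> carrier G" and ordg: "ord g = group_exponent G"
  shows "\<exists>N. subgroup N G \<and> N \<inter> generate G {g} = {\<one>} \<and> generate (G Mod N) {N #> g} = carrier (G Mod N)"
proof -
  let ?C = "generate G {g}"
  have C: "subgroup ?C G" using g by (intro generate_is_subgroup) auto
  let ?D = "{N. subgroup N G \<and> N \<inter> ?C \<subseteq> {\<one>}}"
  have "?D \<subseteq> Pow (carrier G)" by (auto dest: subgroup.subset)
  then have finD: "finite ?D" by (rule finite_subset) simp
  have "{\<one>} \<in> ?D" by (simp add: triv_subgroup)
  then have "Max (card ` ?D) \<in> card ` ?D" using finD by (intro Max_in) auto
  then obtain N where N: "subgroup N G" "N \<inter> ?C \<subseteq> {\<one>}" and max: "card N = Max (card ` ?D)"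
    by auto
  have le: "card P \<le> card N" if "subgroup P G" "P \<inter> ?C \<subseteq> {\<one>}" for P
    unfolding max using finD that by (intro Max_ge) auto
  interpret Q: finite_abelian_group "G Mod N" by (rule quotient_hom[OF N(1)])
  interpret h: group_hom G "G Mod N" "(#>) N" by (rule quotient_hom[OF N(1)])
  have NG: "N \<subseteq> carrier G" using N(1) by (rule subgroup.subset)
  have trivial: "x = \<one>" if "x \<in> N" "x \<in> ?C" for x using N that by blast
  have gQ: "N #> g \<in> carrier (G Mod N)" using g by simp
  have ge: "g [^] (i::nat) \<in> ?C" for i
    using generate_pow_on_finite_carrier[OF finite_carrier g] by auto
  have ord_eq: "group.ord (G Mod N) (N #> g) = ord g"
  proof (subst Q.ord_unique[OF gQ], intro allI)
    fix i :: nat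
    have "(N #> g) [^]\<^bsub>G Mod N\<^esub> i = N #> g [^] i"
      using g by (simp add: h.hom_nat_pow)
    also have "\<dots> = N \<longleftrightarrow> g [^] i \<in> N"
      using g by (intro r_coset_eq_one_iff N) auto
    also have "\<dots> \<longleftrightarrow> g [^] i = \<one>"
      using trivial ge subgroup.one_closed[OF N(1)] by metis
    finally show "(N #> g) [^]\<^bsub>G Mod N\<^esub> i = \<one>\<^bsub>G Mod N\<^esub> \<longleftrightarrow> ord g dvd i"
      using g by (simp add: pow_eq_id)
  qed
  have "generate (G Mod N) {N #> g} = carrier (G Mod N)"
  proof (rule Q.generates_if_no_complement[OF gQ])
    fix X assume "X \<in> carrier (G Mod N)"
    then obtain x where x: "x \<in> carrier G" "X = N #> x" by (auto simp: carrier_FactGroup)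
    have "X [^]\<^bsub>G Mod N\<^esub> ord g = N #> x [^] ord g"
      using x by (simp add: h.hom_nat_pow)
    then show "X [^]\<^bsub>G Mod N\<^esub> group.ord (G Mod N) (N #> g) = \<one>\<^bsub>G Mod N\<^esub>"
      using x NG ordg by (simp add: ord_eq)
  next
    fix P assume P: "subgroup P (G Mod N)" and meet: "P \<inter> generate (G Mod N) {N #> g} \<subseteq> {\<one>\<^bsub>G Mod N\<^esub>}"
    let ?R = "{x \<in> carrier G. N #> x \<in> P}"
    have "?R \<inter> ?C \<subseteq> {\<one>}"
    proof
      fix x assume x: "x \<in> ?R \<inter> ?C"
      then obtain i :: nat where i: "x = g [^] i"
        using generate_pow_on_finite_carrier[OF finite_carrier g] by auto
      have "N #> x = (N #> g) [^]\<^bsub>G Mod N\<^esub> i"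
        using g i by (simp add: h.hom_nat_pow)
      then have "N #> x \<in> generate (G Mod N) {N #> g}"
        using Q.generate_pow_on_finite_carrier[OF Q.finite_carrier gQ] by blast
      then have "N #> x = N" using x meet by auto
      then have "x \<in> N" using x r_coset_eq_one_iff[OF N(1), of x] by simp
      then show "x \<in> {\<one>}" using trivial x by blast
    qed
    then have "card ?R \<le> card N"
      using le subgroup_preimage(1)[OF N(1) P] by blast
    then have "N = ?R"
      using subgroup_preimage(2)[OF N(1) P] by (intro card_seteq) auto
    then show "P = {\<one>\<^bsub>G Mod N\<^esub>}"
      using subgroup_preimage(3)[OF N(1) P] by simp
  qed
  moreover have "N \<inter> ?C = {\<one>}"
    using N subgroup.one_closed[OF N(1)] subgroup.one_closed[OF C] by blast
  ultimately show ?thesis using N(1) by blast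
qed

lemma power_hom:
  assumes y: "y \<in> carrier G" and v: "0 < v" "y [^] v = \<one>"
  shows "(\<lambda>i. y [^] i) \<in> hom (integer_mod_group v) G"
    and "(\<lambda>i::int. y [^] i) ` carrier (integer_mod_group v) = generate G {y}"
proof -
  have "ord y dvd v" using y v by (simp add: pow_eq_id)
  then have reduce: "y [^] (i mod int v) = y [^] i" for i :: int
  proof -
    have "i - i mod int v = int v * (i div int v)"
      by (rule minus_mod_eq_mult_div)
    moreover have "int (ord y) dvd int v" using \<open>ord y dvd v\<close> by simp
    ultimately have "int (ord y) dvd i - i mod int v" by (simp only: dvd_mult2)
    then show ?thesis using y by (simp add: int_pow_eq)
  qed
  show "(\<lambda>i. y [^] i) \<in> hom (integer_mod_group v) G"
    using y by (auto simp: hom_def reduce int_pow_mult)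
  have "y [^] i \<in> (\<lambda>i. y [^] i) ` carrier (integer_mod_group v)" for i :: int
    using v reduce[of i] by (auto simp: carrier_integer_mod_group intro!: image_eqI[of _ _ "i mod int v"])
  then show "(\<lambda>i::int. y [^] i) ` carrier (integer_mod_group v) = generate G {y}"
    unfolding powers_generate[OF y] by auto
qed

text \<open>
  An element whose order is the exponent generates a direct factor, and the quotient by a complement
  is isomorphic to the target.
\<close>

lemma exists_epi_integer_mod_group:
  "\<exists>\<chi>. \<chi> \<in> hom G (integer_mod_group (group_exponent G)) \<and>
    \<chi> ` carrier G = carrier (integer_mod_group (group_exponent G))"
proof -
  let ?v = "group_exponent G"
  let ?Z = "integer_mod_group ?v"
  obtain g where g: "g \<in> carrier G" "ord g = ?v" using exists_ord_eq_exponent by blast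
  obtain N where N: "subgroup N G" "N \<inter> generate G {g} = {\<one>}"
      and gen: "generate (G Mod N) {N #> g} = carrier (G Mod N)"
    using exists_complement[OF g] by blast
  interpret Q: finite_abelian_group "G Mod N" by (rule quotient_hom[OF N(1)])
  interpret h: group_hom G "G Mod N" "(#>) N" by (rule quotient_hom[OF N(1)])
  have NG: "N \<subseteq> carrier G" using N(1) by (rule subgroup.subset)
  have gQ: "N #> g \<in> carrier (G Mod N)" using g by simp
  have pow: "(N #> g) [^]\<^bsub>G Mod N\<^esub> ?v = \<one>\<^bsub>G Mod N\<^esub>"
    using g NG h.hom_nat_pow[OF g(1), of ?v] by simp
  define \<psi> where "\<psi> = (\<lambda>i::int. (N #> g) [^]\<^bsub>G Mod N\<^esub> i)"
  have hom: "\<psi> \<in> hom ?Z (G Mod N)"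
    unfolding \<psi>_def by (rule Q.power_hom(1)[OF gQ exponent_pos pow])
  have surj: "\<psi> ` carrier ?Z = carrier (G Mod N)"
    unfolding \<psi>_def using Q.power_hom(2)[OF gQ exponent_pos pow] gen by simp
  have "inj_on \<psi> (carrier ?Z)"
  proof (rule inj_onI)
    fix i j assume ij: "i \<in> carrier ?Z" "j \<in> carrier ?Z" "\<psi> i = \<psi> j"
    have "N #> g [^] i = N #> g [^] j"
      using ij(3) g by (simp add: \<psi>_def h.hom_int_pow)
    then have "g [^] i \<otimes> inv (g [^] j) \<in> N"
      using r_coset_eq_iff[OF N(1), of "g [^] i" "g [^] j"] g by simp
    moreover have "g [^] i \<otimes> inv (g [^] j) = g [^] (i - j)"
      using g by (simp add: int_pow_diff)
    ultimately have "g [^] (i - j) \<in> N \<inter> generate G {g}"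
      using powers_generate[OF g(1)] by auto
    then have "g [^] (i - j) = \<one>" using N(2) by blast
    then have "int ?v dvd i - j" using g by (simp add: int_pow_eq_id)
    then have "i mod int ?v = j mod int ?v" by (simp add: mod_eq_dvd_iff)
    then show "i = j" using ij exponent_pos by (simp add: carrier_integer_mod_group)
  qed
  then have "\<psi> \<in> iso ?Z (G Mod N)"
    using hom surj by (simp add: iso_def bij_betw_def)
  then have inv: "inv_into (carrier ?Z) \<psi> \<in> iso (G Mod N) ?Z"
    by (rule group.iso_set_sym[OF group_integer_mod_group])
  have "inv_into (carrier ?Z) \<psi> \<circ> (#>) N \<in> hom G ?Z"
    using inv by (intro Group.hom_compose[OF h.homh]) (auto simp: iso_def)
  moreover have "(inv_into (carrier ?Z) \<psi> \<circ> (#>) N) ` carrier G = carrier ?Z"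
    using inv unfolding image_comp [symmetric] carrier_FactGroup [symmetric]
    by (simp add: iso_def bij_betw_def)
  ultimately show ?thesis by blast
qed

section \<open>Preimages of sum-free sets\<close>

lemma card_preimage:
  assumes Q: "group_hom G Q \<phi>" and S: "S \<subseteq> \<phi> ` carrier G"
  shows "card {x \<in> carrier G. \<phi> x \<in> S} * card (\<phi> ` carrier G) = card S * order G"
proof -
  have *: "card {x \<in> carrier G. \<phi> x \<in> T} = card T * card (kernel G Q \<phi>)" if T: "T \<subseteq> \<phi> ` carrier G" for T
  proof -
    have finT: "finite T" using T by (rule finite_subset) simp
    have "{x \<in> carrier G. \<phi> x \<in> T} = (\<Union>s\<in>T. {x \<in> carrier G. \<phi> x = s})" by auto
    then have "card {x \<in> carrier G. \<phi> x \<in> T} = (\<Sum>s\<in>T. card {x \<in> carrier G. \<phi> x = s})"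
      using finT by (simp add: card_UN_disjoint disjoint_iff)
    also have "\<dots> = (\<Sum>s\<in>T. card (kernel G Q \<phi>))"
    proof (rule sum.cong)
      fix s assume "s \<in> T"
      then obtain x where x: "x \<in> carrier G" "s = \<phi> x" using T by auto
      show "card {w \<in> carrier G. \<phi> w = s} = card (kernel G Q \<phi>)"
        using card_fibre[OF Q x(1)] x(2) by simp
    qed simp
    finally show ?thesis by simp
  qed
  have "{x \<in> carrier G. \<phi> x \<in> \<phi> ` carrier G} = carrier G" by auto
  then have "order G = card (\<phi> ` carrier G) * card (kernel G Q \<phi>)"
    using *[of "\<phi> ` carrier G"] by (simp add: order_def)
  then show ?thesis using *[OF S] by simp
qed

lemma hfold_preimage:
  assumes Q: "finite_abelian_group Q" "\<phi> \<in> hom G Q" and S: "S \<subseteq> carrier Q"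
    and x: "x \<in> hfold G h {x \<in> carrier G. \<phi> x \<in> S}"
  shows "\<phi> x \<in> hfold Q h S"
proof -
  interpret Q: finite_abelian_group Q by (rule Q(1))
  interpret h: group_hom G Q \<phi>
    using Q(2) by (simp add: group_hom_def group_hom_axioms_def is_group Q.is_group)
  let ?A = "{x \<in> carrier G. \<phi> x \<in> S}"
  have A: "?A \<subseteq> carrier G" by auto
  show ?thesis
    using x
  proof (induction h arbitrary: x)
    case (Suc h)
    then obtain y a where ya: "y \<in> hfold G h ?A" "a \<in> ?A" "x = y \<otimes> a"
      using hfold_Suc[OF A, of h] by (auto elim!: set_multE)
    have "y \<in> carrier G" using ya hfold_subset_carrier[OF A] by blast
    then have "\<phi> x = \<phi> y \<otimes>\<^bsub>Q\<^esub> \<phi> a" using ya by simp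
    then show ?case using ya Suc.IH[OF ya(1)] Q.hfold_mult_mem[OF S] by simp
  qed simp
qed

lemma sum_free_preimage:
  assumes Q: "finite_abelian_group Q" "\<phi> \<in> hom G Q" and S: "sum_free Q k l S"
  shows "sum_free G k l {x \<in> carrier G. \<phi> x \<in> S}"
proof -
  let ?A = "{x \<in> carrier G. \<phi> x \<in> S}"
  have SQ: "S \<subseteq> carrier Q" "hfold Q k S \<inter> hfold Q l S = {}"
    using S by (auto simp: sum_free_def)
  have "hfold G k ?A \<inter> hfold G l ?A = {}"
  proof (rule ccontr)
    assume "\<not> ?thesis"
    then obtain x where x: "x \<in> hfold G k ?A" "x \<in> hfold G l ?A" by blast
    show False
      using hfold_preimage[OF Q SQ(1) x(1)] hfold_preimage[OF Q SQ(1) x(2)] SQ(2) by blast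
  qed
  then show ?thesis by (auto simp: sum_free_def)
qed

lemma hfold_image:
  assumes Q: "finite_abelian_group Q" "\<phi> \<in> hom G Q" and A: "A \<subseteq> carrier G"
    and y: "y \<in> hfold Q h (\<phi> ` A)"
  shows "y \<in> \<phi> ` hfold G h A"
proof -
  interpret Q: finite_abelian_group Q by (rule Q(1))
  interpret h: group_hom G Q \<phi>
    using Q(2) by (simp add: group_hom_def group_hom_axioms_def is_group Q.is_group)
  have A': "\<phi> ` A \<subseteq> carrier Q" using A by auto
  show ?thesis
    using y
  proof (induction h arbitrary: y)
    case (Suc h)
    then obtain z b where zb: "z \<in> hfold Q h (\<phi> ` A)" "b \<in> \<phi> ` A" "y = z \<otimes>\<^bsub>Q\<^esub> b"
      using Q.hfold_Suc[OF A', of h] by (auto elim!: Q.set_multE)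
    obtain x a where xa: "x \<in> hfold G h A" "z = \<phi> x" "a \<in> A" "b = \<phi> a"
      using Suc.IH[OF zb(1)] zb(2) by auto
    have "x \<in> carrier G" "a \<in> carrier G" using xa A hfold_subset_carrier[OF A] by auto
    then have "y = \<phi> (x \<otimes> a)" using zb xa by simp
    then show ?case using hfold_mult_mem[OF A xa(1,3)] by blast
  qed simp
qed

lemma finite_sum_free_cards: "finite {card A | A. sum_free G k l A}"
proof -
  have "{card A | A. sum_free G k l A} \<subseteq> card ` Pow (carrier G)"
    by (auto simp: sum_free_def)
  then show ?thesis by (rule finite_subset) simp
qed

lemma card_le_max_sum_free: "sum_free G k l A \<Longrightarrow> card A \<le> max_sum_free k l G"
  unfolding max_sum_free_def by (rule Max_ge[OF finite_sum_free_cards]) (auto intro: exI[of _ A])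

lemma exists_max_sum_free:
  assumes "0 < k"
  shows "\<exists>A. sum_free G k l A \<and> card A = max_sum_free k l G"
proof -
  obtain k' where k': "k = Suc k'" using assms by (cases k) auto
  have "hfold G k {} = {}" by (simp add: k' hfold_Suc set_mult_def)
  then have "sum_free G k l {}" by (simp add: sum_free_def)
  then have "{card A | A. sum_free G k l A} \<noteq> {}" by blast
  then have "max_sum_free k l G \<in> {card A | A. sum_free G k l A}"
    unfolding max_sum_free_def by (intro Max_in finite_sum_free_cards)
  then show ?thesis by auto
qed

text \<open>
  All comparisons between two groups below are instances of this inequality between densities, from
  which the denominators have been cleared.
\<close>

lemma sum_free_preimage_card_le:
  assumes Q: "finite_abelian_group Q" "\<phi> \<in> hom G Q" and S: "sum_free Q k l S" "S \<subseteq> \<phi> ` carrier G"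
  shows "card S * order G \<le> max_sum_free k l G * card (\<phi> ` carrier G)"
proof -
  interpret Q: finite_abelian_group Q by (rule Q(1))
  have "group_hom G Q \<phi>"
    using Q(2) by (simp add: group_hom_def group_hom_axioms_def is_group Q.is_group)
  from card_preimage[OF this S(2)] have "card S * order G = card {x \<in> carrier G. \<phi> x \<in> S} * card (\<phi> ` carrier G)"
    by simp
  also have "\<dots> \<le> max_sum_free k l G * card (\<phi> ` carrier G)"
    by (intro mult_right_mono card_le_max_sum_free sum_free_preimage[OF Q S(1)]) simp
  finally show ?thesis .
qed

end

section \<open>Intervals in cyclic groups\<close>

lemma finite_abelian_group_integer_mod_group:
  "0 < v \<Longrightarrow> finite_abelian_group (integer_mod_group v)"
  by (simp add: finite_abelian_group_def finite_abelian_group_axioms_def carrier_integer_mod_group)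

lemma order_integer_mod_group: "0 < v \<Longrightarrow> order (integer_mod_group v) = v"
  by (simp add: order_def carrier_integer_mod_group)

lemma hfold_interval:
  assumes d: "0 < d" and x: "x \<in> hfold (integer_mod_group d) h ((\<lambda>i. (a + i) mod int d) ` {0..q})"
  shows "\<exists>i. 0 \<le> i \<and> i \<le> int h * q \<and> int d dvd x - (int h * a + i)"
proof -
  interpret Z: finite_abelian_group "integer_mod_group d"
    by (rule finite_abelian_group_integer_mod_group[OF d])
  let ?S = "(\<lambda>i. (a + i) mod int d) ` {0..q}"
  have S: "?S \<subseteq> carrier (integer_mod_group d)"
    using d by (auto simp: carrier_integer_mod_group)
  show ?thesis
    using x
  proof (induction h arbitrary: x)
    case 0
    then show ?case by (intro exI[of _ 0]) simp
  next
    case (Suc h)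
    then have "x \<in> hfold (integer_mod_group d) h ?S <#>\<^bsub>integer_mod_group d\<^esub> ?S"
      by (simp add: Z.hfold_Suc[OF S])
    then obtain y b where yb: "y \<in> hfold (integer_mod_group d) h ?S" "b \<in> ?S" "x = (y + b) mod int d"
      by (rule Z.set_multE) simp
    obtain i where i: "0 \<le> i" "i \<le> int h * q" "int d dvd y - (int h * a + i)"
      using Suc.IH[OF yb(1)] by blast
    obtain j where j: "0 \<le> j" "j \<le> q" "b = (a + j) mod int d" using yb(2) by auto
    have "int d dvd x - (y + b)" "int d dvd b - (a + j)"
      unfolding yb(3) j(3) by (simp_all add: mod_eq_dvd_iff [symmetric])
    then have "int d dvd (x - (y + b)) + (b - (a + j)) + (y - (int h * a + i))"
      using i(3) by (intro dvd_add)
    also have "\<dots> = x - (int (Suc h) * a + (i + j))"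
      by (simp add: algebra_simps)
    finally show ?case
      using i j by (intro exI[of _ "i + j"]) (auto simp: algebra_simps)
  qed
qed

text \<open>
  Write \<open>d = q(k+l) + s\<close> with \<open>1 \<le> s \<le> k+l\<close>. For an interval of \<open>q+1\<close> elements that starts at \<open>a\<close>,
  an \<open>l\<close>-fold sum minus a \<open>k\<close>-fold sum is \<open>-(k-l)a\<close> plus a number between \<open>-kq\<close> and \<open>lq\<close>. So the
  interval is sum-free if \<open>(k-l)a\<close> is congruent modulo \<open>d\<close> to one of the \<open>s-1\<close> numbers \<open>w\<close>
  strictly between \<open>lq\<close> and \<open>d-kq = lq+s\<close>. The multiples of \<open>(k-l)\<close> modulo \<open>d\<close> are the multiples of
  \<open>\<delta> = gcd(d,k-l)\<close>, and there is one among the \<open>s-1\<close> candidates if \<open>\<delta> < s\<close>. This is what the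
  hypothesis on \<open>d\<close> expresses.
\<close>

lemma exists_sum_free_interval:
  assumes d: "0 < d" and kl: "0 < l" "l < k"
    and good: "\<forall>j\<in>{1..gcd d (k - l)}. \<not> [d = j] (mod (k + l))"
  shows "\<exists>S. sum_free (integer_mod_group d) k l S \<and> d \<le> (k + l) * card S"
proof -
  define \<delta> where "\<delta> = gcd d (k - l)"
  \<comment> \<open>Dividing \<open>d - 1\<close> and not \<open>d\<close> makes the remainder \<open>s\<close> run from \<open>1\<close> to \<open>k + l\<close>.\<close>
  define q where "q = (d - 1) div (k + l)"
  define s where "s = (d - 1) mod (k + l) + 1"
  have d_eq: "d = q * (k + l) + s"
    using d div_mult_mod_eq[of "d - 1" "k + l"] by (simp add: q_def s_def)
  have s_le: "s \<le> k + l" using kl mod_less_divisor[of "k + l" "d - 1"] by (simp add: s_def Suc_le_eq)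
  have s_gt: "\<delta> < s"
  proof (rule ccontr)
    assume "\<not> \<delta> < s"
    then have "s \<in> {1..gcd d (k - l)}" by (simp add: \<delta>_def s_def)
    moreover have "[d = s] (mod (k + l))"
      unfolding d_eq by (simp add: cong_def)
    ultimately show False using good by blast
  qed
  have \<delta>0: "0 < \<delta>" using d by (simp add: \<delta>_def)
  \<comment> \<open>the least multiple of \<open>\<delta>\<close> beyond \<open>lq\<close>\<close>
  define w where "w = (l * q div \<delta> + 1) * \<delta>"
  have w_gt: "l * q < w"
    using \<delta>0 dividend_less_div_times[of \<delta> "l * q"] by (simp add: w_def algebra_simps)
  have w_le: "w \<le> l * q + \<delta>"
    by (simp add: w_def algebra_simps)
  obtain b where b: "[int (k - l) * b = gcd (int (k - l)) (int d)] (mod int d)"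
    using cong_solve_int by blast
  define a where "a = b * int (l * q div \<delta> + 1)"
  have "[int (k - l) * b * int (l * q div \<delta> + 1) = int \<delta> * int (l * q div \<delta> + 1)] (mod int d)"
    using b by (intro cong_mult) (auto simp: \<delta>_def gcd.commute)
  moreover have "int (k - l) * b * int (l * q div \<delta> + 1) = int (k - l) * a"
    by (simp only: a_def mult.assoc)
  moreover have "int \<delta> * int (l * q div \<delta> + 1) = int w"
    by (simp only: w_def of_nat_mult mult.commute)
  ultimately have "[int (k - l) * a = int w] (mod int d)"
    by (simp only:)
  then have aw: "int d dvd int (k - l) * a - int w"
    by (simp add: cong_iff_dvd_diff)
  define S where "S = (\<lambda>i. (a + i) mod int d) ` {0..int q}"
  have "inj_on (\<lambda>i. (a + i) mod int d) {0..int q}"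
  proof (rule inj_onI)
    fix i j assume ij: "i \<in> {0..int q}" "j \<in> {0..int q}" "(a + i) mod int d = (a + j) mod int d"
    have "q < d" using d_eq kl by (cases "k + l") (auto simp: s_def)
    moreover have "int d dvd i - j" using ij(3) by (simp add: mod_eq_dvd_iff)
    ultimately show "i = j"
      using ij(1,2) zdvd_imp_le[of "int d" "\<bar>i - j\<bar>"] by (cases "i = j") auto
  qed
  then have card_S: "card S = q + 1"
    by (simp add: S_def card_image)
  have "hfold (integer_mod_group d) k S \<inter> hfold (integer_mod_group d) l S = {}"
  proof (rule ccontr)
    assume "\<not> ?thesis"
    then obtain x where x: "x \<in> hfold (integer_mod_group d) k S" "x \<in> hfold (integer_mod_group d) l S"
      by blast
    obtain i where i: "0 \<le> i" "i \<le> int k * int q" "int d dvd x - (int k * a + i)"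
      using hfold_interval[OF d x(1)[unfolded S_def]] by blast
    obtain j where j: "0 \<le> j" "j \<le> int l * int q" "int d dvd x - (int l * a + j)"
      using hfold_interval[OF d x(2)[unfolded S_def]] by blast
    have "int d dvd (x - (int l * a + j)) - (x - (int k * a + i)) - (int (k - l) * a - int w)"
      by (rule dvd_diff[OF dvd_diff[OF j(3) i(3)] aw])
    also have "\<dots> = int w + i - j"
      using kl by (simp add: algebra_simps of_nat_diff)
    finally have dvd: "int d dvd int w + i - j" .
    have "int (l * q) < int w" "int w \<le> int (l * q) + int \<delta>" "int \<delta> < int s"
      using w_gt w_le s_gt by linarith+
    then have "0 < int w + i - j" "int w + i - j < int d"
      using i(1,2) j(1,2) unfolding d_eq by (simp_all add: algebra_simps)
    then show False using dvd zdvd_imp_le by fastforce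
  qed
  moreover have "S \<subseteq> carrier (integer_mod_group d)"
    using d by (auto simp: S_def carrier_integer_mod_group)
  moreover have "d \<le> (k + l) * card S"
    unfolding card_S using s_le by (subst d_eq) (simp add: algebra_simps)
  ultimately show ?thesis by (auto simp: sum_free_def)
qed

lemma mod_hom:
  assumes "0 < v" "d dvd v"
  shows "(\<lambda>x. x mod int d) \<in> hom (integer_mod_group v) (integer_mod_group d)"
    and "(\<lambda>x. x mod int d) ` carrier (integer_mod_group v) = carrier (integer_mod_group d)"
proof -
  have d: "0 < d" "d \<le> v" "int d dvd int v" using assms by (auto intro: dvd_pos_nat dvd_imp_le)
  show "(\<lambda>x. x mod int d) \<in> hom (integer_mod_group v) (integer_mod_group d)"
    using assms(1) d by (auto simp: hom_def carrier_integer_mod_group mod_mod_cancel mod_simps)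
  have "x \<in> (\<lambda>x. x mod int d) ` {0..<int v}" if "0 \<le> x" "x < int d" for x
    using that d by (intro image_eqI[of _ _ x]) auto
  then show "(\<lambda>x. x mod int d) ` carrier (integer_mod_group v) = carrier (integer_mod_group d)"
    using assms(1) d by (auto simp: carrier_integer_mod_group)
qed

lemma max_sum_free_integer_mod_group_ge:
  assumes v: "0 < v" and d: "0 < d" "d dvd v" and kl: "0 < l" "l < k"
    and good: "\<forall>j\<in>{1..gcd d (k - l)}. \<not> [d = j] (mod (k + l))"
  shows "v \<le> (k + l) * max_sum_free k l (integer_mod_group v)"
proof -
  interpret Z: finite_abelian_group "integer_mod_group v"
    by (rule finite_abelian_group_integer_mod_group[OF v])
  obtain S where S: "sum_free (integer_mod_group d) k l S" "d \<le> (k + l) * card S"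
    using exists_sum_free_interval[OF d(1) kl good] by blast
  have range: "(\<lambda>x. x mod int d) ` carrier (integer_mod_group v) = carrier (integer_mod_group d)"
    by (rule mod_hom(2)[OF v d(2)])
  have "card S * order (integer_mod_group v)
      \<le> max_sum_free k l (integer_mod_group v) * card ((\<lambda>x. x mod int d) ` carrier (integer_mod_group v))"
    using S(1) by (intro Z.sum_free_preimage_card_le[OF finite_abelian_group_integer_mod_group[OF d(1)] mod_hom(1)[OF v d(2)]])
      (auto simp: range sum_free_def)
  then have *: "card S * v \<le> max_sum_free k l (integer_mod_group v) * d"
    using v d by (simp add: range order_integer_mod_group flip: order_def)
  have "d * v \<le> (k + l) * card S * v" using S(2) by (rule mult_right_mono) simp
  also have "\<dots> \<le> (k + l) * (max_sum_free k l (integer_mod_group v) * d)"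
    using mult_left_mono[OF *, of "k + l"] by (simp add: mult.assoc)
  finally have "d * v \<le> d * ((k + l) * max_sum_free k l (integer_mod_group v))"
    by (simp add: algebra_simps)
  then show ?thesis using d(1) by simp
qed

context finite_abelian_group
begin

section \<open>Comparison with the cyclic group\<close>

text \<open>
  The subgroup \<open>H\<close> is one of largest size modulo which the two product sets stay disjoint. Any
  enlargement of the trivial subgroup in the quotient by \<open>H\<close> would pull back to a larger subgroup of
  that kind, so the image of \<open>A\<close> in the quotient consists of powers of a single \<open>y\<close>. Powers of \<open>y\<close>
  are parametrised by \<open>\<int>\<^sub>v\<close>, since \<open>y\<close> is annihilated by the exponent \<open>v\<close>.
\<close>

lemma dense_sum_free_le_cyclic:
  assumes A: "sum_free G k l A" and kl: "0 < l" "l < k" and dense: "order G < (k + l) * card A"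
  shows "card A * group_exponent G \<le> max_sum_free k l (integer_mod_group (group_exponent G)) * order G"
proof -
  let ?v = "group_exponent G"
  let ?Z = "integer_mod_group ?v"
  have AG: "A \<subseteq> carrier G" and disj: "hfold G k A \<inter> hfold G l A = {}"
    using A by (auto simp: sum_free_def)
  let ?avoids = "\<lambda>H. \<forall>x\<in>hfold G k A. \<forall>y\<in>hfold G l A. x \<otimes> inv y \<notin> H"
  let ?D = "{H. subgroup H G \<and> ?avoids H}"
  have "?D \<subseteq> Pow (carrier G)" by (auto dest: subgroup.subset)
  then have finD: "finite ?D" by (rule finite_subset) simp
  have foldG: "hfold G h A \<subseteq> carrier G" for h by (rule hfold_subset_carrier[OF AG])
  have "x \<otimes> inv y \<noteq> \<one>" if "x \<in> hfold G k A" "y \<in> hfold G l A" for x y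
  proof
    assume eq: "x \<otimes> inv y = \<one>"
    have "x \<in> carrier G" "y \<in> carrier G" using that foldG by auto
    then have "x = y" using eq by (metis inv_equality inv_inv inv_closed)
    then show False using that disj by blast
  qed
  then have "{\<one>} \<in> ?D" by (simp add: triv_subgroup)
  then have "Max (card ` ?D) \<in> card ` ?D" using finD by (intro Max_in) auto
  then obtain H where H: "subgroup H G" "?avoids H" and max: "card H = Max (card ` ?D)"
    by auto
  have le: "card P \<le> card H" if "subgroup P G" "?avoids P" for P
    unfolding max using finD that by (intro Max_ge) auto
  have HG: "H \<subseteq> carrier G" using H(1) by (rule subgroup.subset)
  let ?Q = "G Mod H"
  interpret Q: finite_abelian_group ?Q by (rule quotient_hom[OF H(1)])
  interpret h: group_hom G ?Q "(#>) H" by (rule quotient_hom[OF H(1)])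
  let ?A = "(#>) H ` A"
  have AQ: "?A \<subseteq> carrier ?Q" using AG by auto
  have range: "(#>) H ` carrier G = carrier ?Q" by (simp add: carrier_FactGroup)
  have fold_image: "hfold ?Q h ?A \<subseteq> (#>) H ` hfold G h A" for h
    using hfold_image[OF Q.finite_abelian_group_axioms h.homh AG] by blast
  have Q_disj: "hfold ?Q k ?A \<inter> hfold ?Q l ?A = {}"
  proof (rule ccontr)
    assume "\<not> ?thesis"
    then obtain x y where xy: "x \<in> hfold G k A" "y \<in> hfold G l A" "H #> x = H #> y"
      using fold_image by blast
    then have "x \<otimes> inv y \<in> H" using r_coset_eq_iff[OF H(1), of x y] foldG by blast
    then show False using H(2) xy by blast
  qed
  have "card A \<le> card {x \<in> carrier G. H #> x \<in> ?A}"
    using AG by (intro card_mono) auto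
  then have "card A * order ?Q \<le> card {x \<in> carrier G. H #> x \<in> ?A} * card ((#>) H ` carrier G)"
    unfolding range order_def by (rule mult_right_mono) simp
  also have "\<dots> = card ?A * order G"
    using AG by (intro card_preimage[OF h.group_hom_axioms]) auto
  finally have card_A: "card A * order ?Q \<le> card ?A * order G" .
  have Q0: "0 < order ?Q" and G0: "0 < order G"
    by (simp_all add: Q.order_gt_0_iff_finite order_gt_0_iff_finite)
  have Q_dense: "order ?Q < (k + l) * card ?A"
  proof -
    have "order G * order ?Q < (k + l) * card A * order ?Q"
      using dense Q0 by simp
    also have "\<dots> \<le> (k + l) * (card ?A * order G)"
      using mult_left_mono[OF card_A, of "k + l"] by (simp add: mult.assoc)
    finally have "order G * order ?Q < order G * ((k + l) * card ?A)"
      by (simp add: algebra_simps)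
    then show ?thesis by simp
  qed
  have "\<not> (\<exists>N. subgroup N ?Q \<and> N \<noteq> {\<one>\<^bsub>?Q\<^esub>} \<and>
    (\<forall>x\<in>hfold ?Q k ?A. \<forall>y\<in>hfold ?Q l ?A. x \<otimes>\<^bsub>?Q\<^esub> inv\<^bsub>?Q\<^esub> y \<notin> N))"
  proof
    assume "\<exists>N. subgroup N ?Q \<and> N \<noteq> {\<one>\<^bsub>?Q\<^esub>} \<and>
      (\<forall>x\<in>hfold ?Q k ?A. \<forall>y\<in>hfold ?Q l ?A. x \<otimes>\<^bsub>?Q\<^esub> inv\<^bsub>?Q\<^esub> y \<notin> N)"
    then obtain N where N: "subgroup N ?Q" "N \<noteq> {H}"
      and avoid: "\<And>x y. x \<in> hfold ?Q k ?A \<Longrightarrow> y \<in> hfold ?Q l ?A \<Longrightarrow> x \<otimes>\<^bsub>?Q\<^esub> inv\<^bsub>?Q\<^esub> y \<notin> N"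
      by auto
    let ?R = "{x \<in> carrier G. H #> x \<in> N}"
    have image_fold: "H #> x \<in> hfold ?Q h ?A" if "x \<in> hfold G h A" for x h
    proof -
      have "hfold G h A \<subseteq> hfold G h {x \<in> carrier G. H #> x \<in> ?A}"
        using AG unfolding hfold_def by (blast intro: Pi_mono)
      then show ?thesis
        using hfold_preimage[OF Q.finite_abelian_group_axioms h.homh AQ] that by blast
    qed
    have "?avoids ?R"
    proof (intro ballI notI)
      fix x y assume xy: "x \<in> hfold G k A" "y \<in> hfold G l A" "x \<otimes> inv y \<in> ?R"
      have "x \<in> carrier G" "y \<in> carrier G" using xy foldG by auto
      then have "(H #> x) \<otimes>\<^bsub>?Q\<^esub> inv\<^bsub>?Q\<^esub> (H #> y) \<in> N"
        using xy(3) by (simp del: mult_FactGroup)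
      then show False using avoid image_fold xy(1,2) by blast
    qed
    then have "card ?R \<le> card H" using le subgroup_preimage(1)[OF H(1) N(1)] by blast
    then have "H = ?R"
      using subgroup_preimage(2)[OF H(1) N(1)] by (intro card_seteq) auto
    then show False using subgroup_preimage(3)[OF H(1) N(1)] N(2) by blast
  qed
  then obtain y where y: "y \<in> carrier ?Q" "?A \<subseteq> generate ?Q {y}"
    using Q.dense_sum_free_cyclic_or_enlarge[OF AQ Q_disj kl Q_dense] by blast
  obtain x where x: "x \<in> carrier G" "y = H #> x"
    using y by (auto simp: carrier_FactGroup)
  have yv: "y [^]\<^bsub>?Q\<^esub> ?v = \<one>\<^bsub>?Q\<^esub>"
    using x HG h.hom_nat_pow[OF x(1), of ?v] by simp
  interpret Z: finite_abelian_group ?Z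
    by (rule finite_abelian_group_integer_mod_group[OF exponent_pos])
  note pow = Q.power_hom[OF y(1) exponent_pos yv]
  have "card ?A * order ?Z \<le> max_sum_free k l ?Z * card ((\<lambda>i::int. y [^]\<^bsub>?Q\<^esub> i) ` carrier ?Z)"
    using AQ Q_disj y(2)
    by (intro Z.sum_free_preimage_card_le[OF Q.finite_abelian_group_axioms pow(1)])
      (auto simp: sum_free_def pow(2))
  also have "\<dots> \<le> max_sum_free k l ?Z * order ?Q"
    unfolding pow(2) order_def using y(1) by (intro mult_left_mono card_mono Q.generate_incl) auto
  finally have *: "card ?A * ?v \<le> max_sum_free k l ?Z * order ?Q"
    by (simp add: order_integer_mod_group exponent_pos)
  have "card A * order ?Q * ?v \<le> card ?A * order G * ?v"
    using card_A by (rule mult_right_mono) simp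
  also have "\<dots> = card ?A * ?v * order G" by simp
  also have "\<dots> \<le> max_sum_free k l ?Z * order ?Q * order G"
    using * by (rule mult_right_mono) simp
  finally have "order ?Q * (card A * ?v) \<le> order ?Q * (max_sum_free k l ?Z * order G)"
    by (simp add: algebra_simps)
  then show ?thesis using Q0 by simp
qed

lemma max_sum_free_ge_cyclic:
  assumes "0 < k"
  shows "max_sum_free k l (integer_mod_group (group_exponent G)) * order G
    \<le> max_sum_free k l G * group_exponent G"
proof -
  let ?Z = "integer_mod_group (group_exponent G)"
  interpret Z: finite_abelian_group ?Z
    by (rule finite_abelian_group_integer_mod_group[OF exponent_pos])
  obtain S where S: "sum_free ?Z k l S" "card S = max_sum_free k l ?Z"
    using Z.exists_max_sum_free[OF assms] by blast
  obtain \<chi> where \<chi>: "\<chi> \<in> hom G ?Z" "\<chi> ` carrier G = carrier ?Z"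
    using exists_epi_integer_mod_group by blast
  have "card S * order G \<le> max_sum_free k l G * card (\<chi> ` carrier G)"
    using S(1) by (intro sum_free_preimage_card_le[OF Z.finite_abelian_group_axioms \<chi>(1)])
      (auto simp: sum_free_def \<chi>(2))
  then show ?thesis
    by (simp add: S(2) \<chi>(2) order_integer_mod_group[OF exponent_pos] flip: order_def)
qed

end

theorem theorem5:
  fixes G :: "('a, 'b) monoid_scheme" and k l n v :: nat
  assumes "l > 0" and "k > l"
    and "comm_group G" and "finite (carrier G)"
    and "order G = n" and "n > 1"
    and "group_exponent G = v"
    and "\<exists>d::nat. d > 0 \<and> d dvd v \<and> (\<forall>j\<in>{1..gcd d (k - l)}. \<not> [d = j] (mod (k + l)))"
  shows "real (max_sum_free k l G)
    = real (max_sum_free k l (integer_mod_group v)) * (real n / real v)"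
proof -
  interpret finite_abelian_group G
    using assms(3,4) by (simp add: finite_abelian_group_def finite_abelian_group_axioms_def)
  let ?Z = "integer_mod_group v"
  have v: "0 < v" using exponent_pos assms(7) by simp
  have lower: "max_sum_free k l ?Z * n \<le> max_sum_free k l G * v"
    using max_sum_free_ge_cyclic[of k l] assms by simp
  obtain A where A: "sum_free G k l A" "card A = max_sum_free k l G"
    using exists_max_sum_free[of k l] assms by auto
  obtain d where d: "0 < d" "d dvd v" "\<forall>j\<in>{1..gcd d (k - l)}. \<not> [d = j] (mod (k + l))"
    using assms(8) by blast
  have "card A * v \<le> max_sum_free k l ?Z * n"
  proof (cases "n < (k + l) * card A")
    case True
    then show ?thesis using dense_sum_free_le_cyclic[OF A(1)] assms by simp
  next
    case False
    then have "(k + l) * card A * v \<le> n * v" by (intro mult_right_mono) auto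
    also have "\<dots> \<le> n * ((k + l) * max_sum_free k l ?Z)"
      using max_sum_free_integer_mod_group_ge[OF v d(1,2) assms(1,2) d(3)] by (rule mult_left_mono) simp
    finally have "(k + l) * (card A * v) \<le> (k + l) * (max_sum_free k l ?Z * n)"
      by (simp add: algebra_simps)
    then show ?thesis using assms(1) by simp
  qed
  then have "max_sum_free k l G * v = max_sum_free k l ?Z * n"
    using lower A(2) by simp
  then have "real (max_sum_free k l G) * real v = real (max_sum_free k l ?Z) * real n"
    by (simp flip: of_nat_mult)
  then show ?thesis using v by (simp add: field_simps)
qed

end
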